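(* For every $n$ there exist a relation $f_0\subseteq\{0,1\}^n\times\{0,1\}^n$ and a partial Boolean function $g_0\subseteq\{0,1\}^n\times\{0,1\}$ such that \[\mathrm{R}_{4/9}(f_0)\in\Theta(\sqrt n),\qquad \mathrm{R}_{1/3}(g_0)\in\Theta(n),\qquad \mathrm{R}_{1/3}(f_0\circ g_0^n)\in\Theta(n).\]
   Context: Partial Boolean function: $g\subseteq\{0,1\}^m\times\{0,1\}$; $g^{-1}(b)$ is the set of $x$ with $(x,b)\in g$, $(x,1-b)\notin g$; non-valid inputs (outside $g^{-1}(0)\cup g^{-1}(1)$) are related to both $0$ and $1$; $g(x)$ is the unique $b$ for valid $x$. Composition: $((x_1,\dots,x_n),s)\in f\circ g^n$ iff some $x_i$ is not valid, or all are valid and $((g(x_1),\dots,g(x_n)),s)\in f$. $\mathrm{R}_\epsilon(h)$ for a relation $h\subseteq\{0,1\}^k\times S$ is the minimum worst-case number of queries of a randomized query algorithm $\mathcal A$ with $\Pr[(x,\mathcal A(x))\in h]\ge1-\epsilon$ for every input $x$. Asymptotic notation is as $n\to\infty$. *)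

theory Defs
  imports "HOL-Probability.Probability" "HOL-Library.Landau_Symbols"
begin

definition bits :: "nat \<Rightarrow> bool list set" where
  "bits k = {x. length x = k}"

definition preimage :: "(bool list \<times> bool) set \<Rightarrow> bool \<Rightarrow> bool list set" where
  "preimage g b = {x. (x, b) \<in> g \<and> (x, \<not> b) \<notin> g}"

definition valid_inputs :: "(bool list \<times> bool) set \<Rightarrow> bool list set" where
  "valid_inputs g = preimage g False \<union> preimage g True"

definition partial_boolean_function :: "nat \<Rightarrow> (bool list \<times> bool) set \<Rightarrow> bool" where
  "partial_boolean_function m g \<longleftrightarrow>
     g \<subseteq> bits m \<times> UNIV \<and>
     (\<forall>x \<in> bits m - valid_inputs g. (x, False) \<in> g \<and> (x, True) \<in> g)"

text \<open>Only meaningful on valid inputs.\<close>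

definition pf_value :: "(bool list \<times> bool) set \<Rightarrow> bool list \<Rightarrow> bool" where
  "pf_value g x = (THE b. (x, b) \<in> g)"

text \<open>
  The relation \<^term>\<open>f\<close> is a subset of \<^term>\<open>bits n \<times> S\<close>, and \<^term>\<open>g\<close> is a partial Boolean
  function on \<^term>\<open>bits m\<close>. An \<^term>\<open>n\<close>-tuple of \<^term>\<open>m\<close>-bit blocks is identified with the
  concatenation of the blocks, an element of \<^term>\<open>bits (n * m)\<close>.
\<close>

definition compose_rel ::
  "nat \<Rightarrow> nat \<Rightarrow> 's set \<Rightarrow> (bool list \<times> 's) set \<Rightarrow> (bool list \<times> bool) set \<Rightarrow> (bool list \<times> 's) set"
where
  "compose_rel n m S f g =
     {(concat xs, s) | xs s.
        length xs = n \<and> set xs \<subseteq> bits m \<and> s \<in> S \<and>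
        ((\<exists>x \<in> set xs. x \<notin> valid_inputs g) \<or>
         (\<forall>x \<in> set xs. x \<in> valid_inputs g) \<and> (map (pf_value g) xs, s) \<in> f)}"

datatype 's dtree = Output 's | Query nat "'s dtree" "'s dtree"

fun queried_indices :: "'s dtree \<Rightarrow> nat set" where
  "queried_indices (Output s) = {}"
| "queried_indices (Query i t0 t1) = insert i (queried_indices t0 \<union> queried_indices t1)"

fun run :: "'s dtree \<Rightarrow> bool list \<Rightarrow> 's" where
  "run (Output s) x = s"
| "run (Query i t0 t1) x = run (if x ! i then t1 else t0) x"

fun query_count :: "'s dtree \<Rightarrow> bool list \<Rightarrow> nat" where
  "query_count (Output s) x = 0"
| "query_count (Query i t0 t1) x = Suc (query_count (if x ! i then t1 else t0) x)"

text \<open>A randomized query algorithm is a probability distribution over deterministic decision trees.\<close>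

definition query_algorithm :: "nat \<Rightarrow> 's dtree pmf \<Rightarrow> bool" where
  "query_algorithm k A \<longleftrightarrow> (\<forall>t \<in> set_pmf A. queried_indices t \<subseteq> {..<k})"

definition max_queries_le :: "nat \<Rightarrow> 's dtree pmf \<Rightarrow> nat \<Rightarrow> bool" where
  "max_queries_le k A q \<longleftrightarrow> (\<forall>x \<in> bits k. \<forall>t \<in> set_pmf A. query_count t x \<le> q)"

definition computes_with_error ::
  "real \<Rightarrow> nat \<Rightarrow> 's dtree pmf \<Rightarrow> (bool list \<times> 's) set \<Rightarrow> bool"
where
  "computes_with_error \<epsilon> k A h \<longleftrightarrow>
     (\<forall>x \<in> bits k. measure_pmf.prob A {t. (x, run t x) \<in> h} \<ge> 1 - \<epsilon>)"

text \<open>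
  If no algorithm computes \<^term>\<open>h\<close> with error \<^term>\<open>\<epsilon>\<close>, the infimum is over the empty set and
  equals \<^term>\<open>0::nat\<close>. A lower bound tending to infinity therefore still entails that algorithms
  exist for all large input lengths.
\<close>

definition randomized_query_complexity ::
  "real \<Rightarrow> nat \<Rightarrow> (bool list \<times> 's) set \<Rightarrow> nat"
where
  "randomized_query_complexity \<epsilon> k h =
     Inf {q. \<exists>A. query_algorithm k A \<and> computes_with_error \<epsilon> k A h \<and> max_queries_le k A q}"

end

theory Submission
  imports Defs
begin

text \<open>
  Take for \<open>f\<close> the relation of all \<open>(z, a)\<close> such that \<open>a\<close> agrees with \<open>z\<close> in at least
  \<open>n/2 + \<surd>n\<close> positions, and for \<open>g\<close> the majority function with a promised gap of about \<open>2\<surd>n\<close>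
  from \<open>n/2\<close>. A random guess of \<open>z\<close> deviates from \<open>n/2\<close> agreements by order \<open>\<surd>n\<close>, so about
  \<open>\<surd>n\<close> queries are needed and suffice for \<open>f\<close>. In the composition, a single random query to a
  block already gives its majority with advantage \<open>2/\<surd>n\<close>, and over \<open>n\<close> blocks these advantages
  add up to the required surplus.

  Conversely, let the blocks of the composition be independent and uniform among the strings with
  exactly \<open>k\<close> equal bits, \<open>k\<close> the promise threshold. Given the answers to \<open>q\<^sub>i\<close> queries in block
  \<open>i\<close>, a ratio of binomial coefficients shows that its value has conditional bias
  \<open>O(q\<^sub>i/\<surd>n)\<close>. Hence at every leaf of a tree with \<open>\<delta>n\<close> queries the biases sum to at most
  \<open>O(\<delta>\<surd>n)\<close>, and Chebyshev's inequality, applied leaf by leaf, rules out the surplus. The lower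
  bound for \<open>f\<close> is the same argument with blocks of one bit.

  For \<open>g\<close>, compare independent bits of bias \<open>\<plusminus>16/\<surd>n\<close>: these inputs satisfy the promise with
  probability \<open>99/100\<close>, and every query multiplies the Bhattacharyya coefficient of the two
  transcript distributions by at least \<open>\<surd>(1 - 256/n)\<close>, so \<open>\<Omega>(n)\<close> queries are
  needed to tell them apart.
\<close>

section \<open>Chebyshev's inequality on product spaces\<close>

lemma listset_Cons_eq_image:
  "listset (C # Cs) = (\<lambda>(x, xs). x # xs) ` (C \<times> listset Cs)"
  by (auto simp: set_Cons_def)

lemma mem_listset_iff:
  "xs \<in> listset Cs \<longleftrightarrow> length xs = length Cs \<and> (\<forall>i<length Cs. xs ! i \<in> Cs ! i)"
proof (induction Cs arbitrary: xs)
  case Nil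
  then show ?case by simp
next
  case (Cons C Cs)
  show ?case
    by (cases xs) (auto simp: set_Cons_def Cons.IH nth_Cons' less_Suc_eq_0_disj)
qed

lemma finite_listset:
  "(\<And>i. i < length Cs \<Longrightarrow> finite (Cs ! i)) \<Longrightarrow> finite (listset Cs)"
proof (induction Cs)
  case (Cons C Cs)
  have "finite C" using Cons.prems[of 0] by simp
  moreover have "finite (listset Cs)" using Cons.prems[of "Suc i" for i] by (intro Cons.IH) auto
  ultimately show ?case by (subst listset_Cons_eq_image) auto
qed simp

lemma sum_listset_Cons:
  "(\<Sum>zs\<in>listset (C # Cs). F zs) = (\<Sum>x\<in>C. \<Sum>xs\<in>listset Cs. F (x # xs))"
proof -
  have "inj_on (\<lambda>(x, xs). x # xs) (C \<times> listset Cs)" by (auto simp: inj_on_def)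
  then show ?thesis
    by (simp only: listset_Cons_eq_image sum.reindex sum.cartesian_product) (auto intro: sum.cong)
qed

lemma sum_listset_prod_list:
  fixes w :: "'a \<Rightarrow> real"
  shows "(\<Sum>xs\<in>listset Cs. prod_list (map w xs)) = (\<Prod>i<length Cs. \<Sum>x\<in>Cs ! i. w x)"
proof (induction Cs)
  case (Cons C Cs)
  have "(\<Sum>xs\<in>listset (C # Cs). prod_list (map w xs)) =
        (\<Sum>x\<in>C. w x * (\<Sum>xs\<in>listset Cs. prod_list (map w xs)))"
    by (simp add: sum_listset_Cons sum_distrib_left del: listset.simps)
  then show ?case
    by (simp add: Cons.IH prod.lessThan_Suc_shift sum_distrib_right del: listset.simps prod.lessThan_Suc)
qed simp

text \<open>Centring only the head coordinate already kills the cross term, so no first moment of the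
  tail is needed.\<close>

lemma product_second_moment:
  fixes w :: "'a \<Rightarrow> real" and \<tau> :: "nat \<Rightarrow> 'a \<Rightarrow> real"
  assumes "\<And>x. 0 \<le> w x"
    and "\<And>i. i < length Cs \<Longrightarrow> (\<Sum>x\<in>Cs ! i. w x * \<tau> i x) = 0"
    and "\<And>i. i < length Cs \<Longrightarrow> (\<Sum>x\<in>Cs ! i. w x * (\<tau> i x)\<^sup>2) \<le> (\<Sum>x\<in>Cs ! i. w x)"
  shows "(\<Sum>xs\<in>listset Cs. prod_list (map w xs) * (\<Sum>i<length Cs. \<tau> i (xs ! i))\<^sup>2)
       \<le> real (length Cs) * (\<Sum>xs\<in>listset Cs. prod_list (map w xs))"
  using assms(2,3)
proof (induction Cs arbitrary: \<tau>)
  case Nil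
  then show ?case by simp
next
  case (Cons C Cs)
  let ?W = "\<lambda>xs. prod_list (map w xs)"
  let ?S = "\<lambda>xs. \<Sum>i<length Cs. \<tau> (Suc i) (xs ! i)"
  define Z where "Z = (\<Sum>x\<in>C. w x)"
  define Z' where "Z' = (\<Sum>xs\<in>listset Cs. ?W xs)"
  have IH: "(\<Sum>xs\<in>listset Cs. ?W xs * (?S xs)\<^sup>2) \<le> real (length Cs) * Z'"
    unfolding Z'_def using Cons.prems[of "Suc i" for i] by (intro Cons.IH) auto
  have m1: "(\<Sum>x\<in>C. w x * \<tau> 0 x) = 0" and m2: "(\<Sum>x\<in>C. w x * (\<tau> 0 x)\<^sup>2) \<le> Z"
    using Cons.prems[of 0] by (auto simp: Z_def)
  have Z: "0 \<le> Z" unfolding Z_def by (intro sum_nonneg assms(1))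
  have W: "0 \<le> ?W xs" for xs by (induction xs) (auto intro: mult_nonneg_nonneg assms(1))
  have Z': "0 \<le> Z'" unfolding Z'_def by (intro sum_nonneg W)
  have "(\<Sum>xs\<in>listset (C # Cs). ?W xs * (\<Sum>i<length (C # Cs). \<tau> i (xs ! i))\<^sup>2)
     = (\<Sum>x\<in>C. \<Sum>xs\<in>listset Cs. w x * ?W xs * (\<tau> 0 x + ?S xs)\<^sup>2)"
    by (simp add: sum_listset_Cons sum.lessThan_Suc_shift del: listset.simps sum.lessThan_Suc)
  also have "\<dots> = (\<Sum>x\<in>C. \<Sum>xs\<in>listset Cs. (w x * (\<tau> 0 x)\<^sup>2) * ?W xs
       + (w x * \<tau> 0 x) * (2 * ?W xs * ?S xs) + w x * (?W xs * (?S xs)\<^sup>2))"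
    by (intro sum.cong refl) (simp add: power2_eq_square algebra_simps)
  also have "\<dots> = (\<Sum>x\<in>C. w x * (\<tau> 0 x)\<^sup>2) * Z'
       + (\<Sum>x\<in>C. w x * \<tau> 0 x) * (\<Sum>xs\<in>listset Cs. 2 * ?W xs * ?S xs)
       + Z * (\<Sum>xs\<in>listset Cs. ?W xs * (?S xs)\<^sup>2)"
    unfolding Z_def Z'_def by (simp only: sum.distrib sum_product)
  \<comment> \<open>The mixed sum has a factor that \<open>m1\<close> makes zero; \<open>m2\<close>
    and \<open>IH\<close> bound the two square terms.\<close>
  also have "\<dots> \<le> Z * Z' + Z * (real (length Cs) * Z')"
    using m1 mult_right_mono[OF m2 Z'] mult_left_mono[OF IH Z] by simp
  also have "\<dots> = real (length (C # Cs)) * (Z * Z')"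
    by (simp add: algebra_simps)
  also have "Z * Z' = (\<Sum>xs\<in>listset (C # Cs). ?W xs)"
    by (simp add: sum_listset_Cons Z_def Z'_def sum_product del: listset.simps)
  finally show ?case .
qed

text \<open>Markov's inequality for the squared deviation, whose mean
  \<open>product_second_moment\<close> bounds after centring \<open>\<sigma> i\<close> at
  \<open>\<mu> i\<close>. The weights are not normalized, so one statement covers both counting and
  biased product measures.\<close>

lemma product_Chebyshev:
  fixes w :: "'a \<Rightarrow> real" and \<sigma> :: "nat \<Rightarrow> 'a \<Rightarrow> real"
  assumes w: "\<And>x. 0 \<le> w x"
    and fin: "\<And>i. i < length Cs \<Longrightarrow> finite (Cs ! i)"
    and pos: "\<And>i. i < length Cs \<Longrightarrow> 0 < (\<Sum>x\<in>Cs ! i. w x)"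
    and \<mu>: "\<And>i. i < length Cs \<Longrightarrow> (\<Sum>x\<in>Cs ! i. w x * \<sigma> i x) = \<mu> i * (\<Sum>x\<in>Cs ! i. w x)"
    and \<sigma>: "\<And>i x. (\<sigma> i x)\<^sup>2 \<le> 1"
    and t: "0 \<le> t"
    and P: "\<And>xs. xs \<in> listset Cs \<Longrightarrow> P xs \<Longrightarrow>
              t \<le> \<bar>(\<Sum>i<length Cs. \<sigma> i (xs ! i)) - (\<Sum>i<length Cs. \<mu> i)\<bar>"
  shows "t\<^sup>2 * (\<Sum>xs | xs \<in> listset Cs \<and> P xs. prod_list (map w xs))
       \<le> real (length Cs) * (\<Sum>xs\<in>listset Cs. prod_list (map w xs))"
proof -
  let ?W = "\<lambda>xs. prod_list (map w xs)"
  let ?T = "\<lambda>xs. \<Sum>i<length Cs. \<sigma> i (xs ! i) - \<mu> i"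
  have W: "0 \<le> ?W xs" for xs by (induction xs) (auto intro: mult_nonneg_nonneg w)
  have fin': "finite (listset Cs)" using fin by (rule finite_listset)
  have "t\<^sup>2 * (\<Sum>xs | xs \<in> listset Cs \<and> P xs. ?W xs)
      \<le> (\<Sum>xs | xs \<in> listset Cs \<and> P xs. ?W xs * (?T xs)\<^sup>2)"
    unfolding sum_distrib_left
  proof (rule sum_mono)
    fix xs assume "xs \<in> {xs \<in> listset Cs. P xs}"
    then have "t \<le> \<bar>?T xs\<bar>" using P[of xs] by (simp add: sum_subtractf)
    then have "t\<^sup>2 \<le> (?T xs)\<^sup>2" using t by (metis abs_le_square_iff abs_of_nonneg)
    then show "t\<^sup>2 * ?W xs \<le> ?W xs * (?T xs)\<^sup>2"
      by (subst mult.commute) (rule mult_left_mono[OF _ W])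
  qed
  also have "\<dots> \<le> (\<Sum>xs\<in>listset Cs. ?W xs * (?T xs)\<^sup>2)"
    by (intro sum_mono2 fin') (auto intro: mult_nonneg_nonneg W)
  also have "\<dots> \<le> real (length Cs) * (\<Sum>xs\<in>listset Cs. ?W xs)"
  proof (rule product_second_moment[OF w])
    fix i assume i: "i < length Cs"
    let ?Z = "\<Sum>x\<in>Cs ! i. w x"
    show "(\<Sum>x\<in>Cs ! i. w x * (\<sigma> i x - \<mu> i)) = 0"
      using \<mu>[OF i] by (simp add: right_diff_distrib sum_subtractf flip: sum_distrib_right)
    \<comment> \<open>Up to the total weight, the variance is the second moment minus the squared
      mean, hence at most one.\<close>
    have "(\<Sum>x\<in>Cs ! i. w x * (\<sigma> i x - \<mu> i)\<^sup>2)
        = (\<Sum>x\<in>Cs ! i. w x * (\<sigma> i x)\<^sup>2) - 2 * \<mu> i * (\<Sum>x\<in>Cs ! i. w x * \<sigma> i x) + (\<mu> i)\<^sup>2 * ?Z"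
      unfolding sum_distrib_left sum_subtractf[symmetric] sum.distrib[symmetric]
      by (intro sum.cong refl) (simp add: power2_eq_square algebra_simps)
    also have "\<dots> = (\<Sum>x\<in>Cs ! i. w x * (\<sigma> i x)\<^sup>2) - (\<mu> i)\<^sup>2 * ?Z"
      unfolding \<mu>[OF i] by (simp add: power2_eq_square algebra_simps)
    also have "\<dots> \<le> (\<Sum>x\<in>Cs ! i. w x * (\<sigma> i x)\<^sup>2)"
      using pos[OF i] by simp
    also have "\<dots> \<le> (\<Sum>x\<in>Cs ! i. w x * 1)"
      by (intro sum_mono mult_left_mono \<sigma> w)
    finally show "(\<Sum>x\<in>Cs ! i. w x * (\<sigma> i x - \<mu> i)\<^sup>2) \<le> ?Z" by simp
  qed
  finally show ?thesis .
qed

text \<open>Unit weights turn the weighted sums into cardinalities.\<close>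

lemma uniform_product_Chebyshev:
  fixes \<sigma> :: "nat \<Rightarrow> 'a \<Rightarrow> real"
  assumes "\<And>i. i < length Cs \<Longrightarrow> finite (Cs ! i) \<and> Cs ! i \<noteq> {}"
    and "\<And>i. i < length Cs \<Longrightarrow> (\<Sum>x\<in>Cs ! i. \<sigma> i x) = \<mu> i * real (card (Cs ! i))"
    and "\<And>i x. (\<sigma> i x)\<^sup>2 \<le> 1"
    and "0 \<le> t"
    and "\<And>xs. xs \<in> listset Cs \<Longrightarrow> P xs \<Longrightarrow>
           t \<le> \<bar>(\<Sum>i<length Cs. \<sigma> i (xs ! i)) - (\<Sum>i<length Cs. \<mu> i)\<bar>"
  shows "t\<^sup>2 * real (card {xs \<in> listset Cs. P xs}) \<le> real (length Cs) * real (card (listset Cs))"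
proof -
  have one: "prod_list (map (\<lambda>_. 1) xs) = (1::real)" for xs :: "'a list" by (induction xs) auto
  show ?thesis
    using product_Chebyshev[of "\<lambda>_. 1" Cs \<sigma> \<mu> t P] assms
    by (simp add: one card_gt_0_iff)
qed

section \<open>Randomized decision trees\<close>

text \<open>Every upper bound below comes from nonadaptive trees: the positions are fixed in advance
  and \<open>F\<close> reads the list of answers.\<close>

fun query_all :: "nat list \<Rightarrow> (bool list \<Rightarrow> 's) \<Rightarrow> 's dtree" where
  "query_all [] F = Output (F [])"
| "query_all (i # js) F =
     Query i (query_all js (\<lambda>bs. F (False # bs))) (query_all js (\<lambda>bs. F (True # bs)))"

lemma run_query_all: "run (query_all js F) x = F (map (\<lambda>i. x ! i) js)"
  by (induction js arbitrary: F) auto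

lemma query_count_query_all: "query_count (query_all js F) x = length js"
  by (induction js arbitrary: F) auto

lemma queried_indices_query_all: "queried_indices (query_all js F) \<subseteq> set js"
proof (induction js arbitrary: F)
  case (Cons i js)
  from Cons.IH[of "\<lambda>bs. F (False # bs)"] Cons.IH[of "\<lambda>bs. F (True # bs)"]
  show ?case by auto
qed simp

text \<open>Existence is kept apart from the infimum, which is \<open>0\<close> on the empty set:
  lower bounds refute this predicate instead of estimating the infimum directly.\<close>

definition has_algorithm :: "real \<Rightarrow> nat \<Rightarrow> (bool list \<times> 's) set \<Rightarrow> nat \<Rightarrow> bool" where
  "has_algorithm \<epsilon> k h q \<longleftrightarrow>
     (\<exists>A. query_algorithm k A \<and> computes_with_error \<epsilon> k A h \<and> max_queries_le k A q)"

lemma randomized_query_complexity_le: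
  "has_algorithm \<epsilon> k h q \<Longrightarrow> randomized_query_complexity \<epsilon> k h \<le> q"
  unfolding has_algorithm_def randomized_query_complexity_def by (intro cInf_lower) auto

lemma has_algorithm_randomized_query_complexity:
  "has_algorithm \<epsilon> k h q \<Longrightarrow> has_algorithm \<epsilon> k h (randomized_query_complexity \<epsilon> k h)"
  using Inf_nat_def1[of "{q. has_algorithm \<epsilon> k h q}"]
  unfolding has_algorithm_def randomized_query_complexity_def by blast

text \<open>The random seed \<open>r\<close> picks a nonadaptive tree, so for a fixed input the
  error probability is the fraction of bad seeds.\<close>

lemma has_algorithm_uniform_seed:
  assumes R: "finite R" "R \<noteq> {}"
    and js: "\<And>r. r \<in> R \<Longrightarrow> set (js r) \<subseteq> {..<k}" "\<And>r. r \<in> R \<Longrightarrow> length (js r) \<le> q"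
    and err: "\<And>x. x \<in> bits k \<Longrightarrow>
       real (card {r \<in> R. (x, F r (map (\<lambda>i. x ! i) (js r))) \<notin> h}) \<le> \<epsilon> * real (card R)"
  shows "has_algorithm \<epsilon> k h q"
proof -
  define A where "A = map_pmf (\<lambda>r. query_all (js r) (F r)) (pmf_of_set R)"
  have "query_algorithm k A"
    using R order_trans[OF queried_indices_query_all js(1)] unfolding query_algorithm_def A_def by auto
  moreover have "max_queries_le k A q"
    using js(2) R unfolding max_queries_le_def A_def by (auto simp: query_count_query_all)
  moreover have "computes_with_error \<epsilon> k A h"
    unfolding computes_with_error_def
  proof
    fix x assume x: "x \<in> bits k"
    let ?G = "{r \<in> R. (x, F r (map (\<lambda>i. x ! i) (js r))) \<in> h}"
    let ?B = "{r \<in> R. (x, F r (map (\<lambda>i. x ! i) (js r))) \<notin> h}"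
    have "card R = card ?G + card ?B"
      using R by (subst card_Un_disjoint[symmetric]) (auto intro: arg_cong[of _ _ card])
    then have c: "real (card ?G) \<ge> (1 - \<epsilon>) * real (card R)"
      using err[OF x] by (simp add: algebra_simps)
    have "measure_pmf.prob A {t. (x, run t x) \<in> h} = real (card ?G) / real (card R)"
      using R unfolding A_def
      by (simp add: measure_pmf_of_set run_query_all vimage_def Int_def)
    also have "\<dots> \<ge> 1 - \<epsilon>"
      using c R by (simp add: pos_le_divide_eq card_gt_0_iff)
    finally show "measure_pmf.prob A {t. (x, run t x) \<in> h} \<ge> 1 - \<epsilon>" .
  qed
  ultimately show ?thesis unfolding has_algorithm_def by blast
qed

text \<open>The easy direction of Yao's principle: exchanging the finite sum with the expectation
  over trees, a bound for every tree in the support passes to the mixture. Weights of either sign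
  are allowed, so a difference of two input distributions is covered.\<close>

lemma sum_weighted_prob_le:
  fixes w :: "'x \<Rightarrow> real"
  assumes "finite X"
    and "\<And>t. t \<in> set_pmf A \<Longrightarrow> (\<Sum>x\<in>X. w x * of_bool (P x t)) \<le> c"
  shows "(\<Sum>x\<in>X. w x * measure_pmf.prob A {t. P x t}) \<le> c"
proof -
  have ind: "(\<lambda>t. of_bool (P x t) :: real) = indicator {t. P x t}" for x
    by (auto simp: indicator_def)
  have prob: "measure_pmf.prob A {t. P x t} = measure_pmf.expectation A (\<lambda>t. of_bool (P x t))" for x
    unfolding ind by simp
  have int: "integrable (measure_pmf A) (\<lambda>t. of_bool (P x t) :: real)" for x
    by (intro measure_pmf.integrable_const_bound[of _ 1]) auto
  have "(\<Sum>x\<in>X. w x * measure_pmf.prob A {t. P x t})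
      = (\<Sum>x\<in>X. measure_pmf.expectation A (\<lambda>t. w x * of_bool (P x t)))"
    by (simp add: prob)
  also have "\<dots> = measure_pmf.expectation A (\<lambda>t. \<Sum>x\<in>X. w x * of_bool (P x t))"
    using int by (subst Bochner_Integration.integral_sum) auto
  also have "\<dots> \<le> c"
    using assms(2) int by (intro measure_pmf.integral_le_const) (auto simp: AE_measure_pmf_iff)
  finally show ?thesis .
qed

section \<open>Transcripts, cylinders and hard input sets\<close>

text \<open>A set of pairs (position, answer) records a transcript. Order and repetitions do not
  matter, and contradictory pairs give the empty cylinder.\<close>

definition cyl :: "(nat \<times> bool) set \<Rightarrow> bool list set" where
  "cyl L = {x. \<forall>(i, b)\<in>L. x ! i = b}"

lemma cyl_insert: "cyl (insert (i, b) L) = {x \<in> cyl L. x ! i = b}"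
  by (auto simp: cyl_def)

text \<open>The leaves cut \<open>X\<close> into cylinders, and on each of them the tree gives one
  fixed answer \<open>s\<close>. A bound \<open>c\<close> for the success rate of every fixed answer
  on every small cylinder therefore adds up over the leaves. The set \<open>L\<close> collects the
  answers on the path so far.\<close>

lemma card_tree_success_le:
  fixes h :: "(bool list \<times> 's) set"
  assumes X: "finite X"
    and leaf: "\<And>L s. finite L \<Longrightarrow> card L \<le> q \<Longrightarrow> fst ` L \<subseteq> {..<k} \<Longrightarrow>
       real (card {x \<in> X \<inter> cyl L. (x, s) \<in> h}) \<le> c * real (card (X \<inter> cyl L))"
    and L: "finite L" "fst ` L \<subseteq> {..<k}"
    and t: "queried_indices t \<subseteq> {..<k}"
    and q: "\<And>x. x \<in> X \<inter> cyl L \<Longrightarrow> card L + query_count t x \<le> q"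
  shows "real (card {x \<in> X \<inter> cyl L. (x, run t x) \<in> h}) \<le> c * real (card (X \<inter> cyl L))"
  using L t q
proof (induction t arbitrary: L)
  case (Output s)
  show ?case
  \<comment> \<open>On an empty cylinder the query bound says nothing about \<open>card L\<close>,
    but there is nothing to count either.\<close>
  proof (cases "X \<inter> cyl L = {}")
    case True
    then show ?thesis by simp
  next
    case False
    then have "card L \<le> q" using Output.prems(4) by fastforce
    then show ?thesis using leaf Output.prems by simp
  qed
next
  case (Query i t0 t1)
  define sub where "sub = (\<lambda>b. if b then t1 else t0)"
  let ?L = "\<lambda>b. insert (i, b) L"
  have IH: "real (card {x \<in> X \<inter> cyl (?L b). (x, run (sub b) x) \<in> h}) \<le> c * real (card (X \<inter> cyl (?L b)))"
    for b
  proof -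
    have qc: "card (?L b) + query_count (sub b) x \<le> q" if x: "x \<in> X \<inter> cyl (?L b)" for x
    proof -
      have "x \<in> X \<inter> cyl L" "x ! i = b" using x by (auto simp: cyl_insert)
      \<comment> \<open>A repeated query may leave \<open>L\<close> unchanged, so its size grows by
        at most one.\<close>
      from Query.prems(4)[OF this(1)] this(2) show ?thesis
        using Query.prems(1) card_insert_le_m1[of "Suc (card L)" L "(i, b)"] by (simp add: sub_def)
    qed
    show ?thesis
      using Query.IH(1)[of "?L b"] Query.IH(2)[of "?L b"] Query.prems qc by (cases b) (simp_all add: sub_def)
  qed
  have split: "card {x \<in> X \<inter> cyl L. R x} = card {x \<in> X \<inter> cyl (?L True). R x} + card {x \<in> X \<inter> cyl (?L False). R x}" for R
    using X by (subst card_Un_disjoint[symmetric]) (auto simp: cyl_insert intro!: arg_cong[of _ _ card])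
  have total: "card (X \<inter> cyl L) = card (X \<inter> cyl (?L True)) + card (X \<inter> cyl (?L False))"
    using split[of "\<lambda>_. True"] by (simp add: Int_def)
  have succ: "{x \<in> X \<inter> cyl (?L b). (x, run (Query i t0 t1) x) \<in> h} = {x \<in> X \<inter> cyl (?L b). (x, run (sub b) x) \<in> h}" for b
    by (auto simp: cyl_insert sub_def)
  show ?case
    using split[of "\<lambda>x. (x, run (Query i t0 t1) x) \<in> h"] total IH[of True] IH[of False]
    unfolding succ by (simp add: distrib_left)
qed

text \<open>Yao's principle for the uniform distribution on \<open>X\<close>: a correct algorithm
  succeeds with average probability at least \<open>1 - \<epsilon>\<close>, while every
  deterministic tree succeeds on at most a fraction \<open>c\<close>.\<close>

lemma not_has_algorithm_if_hard_set:
  fixes h :: "(bool list \<times> 's) set"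
  assumes X: "finite X" "X \<noteq> {}" "X \<subseteq> bits k"
    and leaf: "\<And>L s. finite L \<Longrightarrow> card L \<le> q \<Longrightarrow> fst ` L \<subseteq> {..<k} \<Longrightarrow>
       real (card {x \<in> X \<inter> cyl L. (x, s) \<in> h}) \<le> c * real (card (X \<inter> cyl L))"
    and c: "c < 1 - \<epsilon>"
  shows "\<not> has_algorithm \<epsilon> k h q"
proof
  assume "has_algorithm \<epsilon> k h q"
  then obtain A where A: "query_algorithm k A" "computes_with_error \<epsilon> k A h" "max_queries_le k A q"
    unfolding has_algorithm_def by blast
  have "(\<Sum>x\<in>X. 1 * measure_pmf.prob A {t. (x, run t x) \<in> h}) \<le> c * real (card X)"
  proof (rule sum_weighted_prob_le[OF X(1)])
    fix t assume t: "t \<in> set_pmf A"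
    have cyl0: "cyl {} = UNIV" by (simp add: cyl_def)
    have "real (card {x \<in> X \<inter> cyl {}. (x, run t x) \<in> h}) \<le> c * real (card (X \<inter> cyl {}))"
      using A t X by (intro card_tree_success_le[OF X(1) leaf])
        (auto simp: query_algorithm_def max_queries_le_def)
    then show "(\<Sum>x\<in>X. 1 * of_bool ((x, run t x) \<in> h)) \<le> c * real (card X)"
      using X(1) by (simp add: cyl0 Int_def)
  qed
  moreover have "(\<Sum>x\<in>X. 1 - \<epsilon>) \<le> (\<Sum>x\<in>X. 1 * measure_pmf.prob A {t. (x, run t x) \<in> h})"
    using A(2) X(3) by (intro sum_mono) (auto simp: computes_with_error_def)
  ultimately have "(1 - \<epsilon>) * real (card X) \<le> c * real (card X)" by (simp add: mult.commute)
  then show False using c X by (simp add: card_gt_0_iff)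
qed

section \<open>The relation and the partial function\<close>

text \<open>Agreements minus disagreements, so that a uniform guess has mean zero. The value
  \<open>2 * sqrt n\<close> corresponds to \<open>n/2 + sqrt n\<close> agreements.\<close>

definition agreement :: "bool list \<Rightarrow> bool list \<Rightarrow> real" where
  "agreement z a = (\<Sum>i<length z. if z ! i = a ! i then 1 else - 1)"

definition close_rel :: "nat \<Rightarrow> (bool list \<times> bool list) set" where
  "close_rel n = {(z, a). z \<in> bits n \<and> a \<in> bits n \<and> 2 * sqrt (real n) \<le> agreement z a}"

text \<open>The least integer strictly above \<open>n/2 + 2 * sqrt n\<close>. Strictness keeps it
  above \<open>n/2\<close> even for \<open>n = 0\<close>, so opposite values never both reach
  it.\<close>

definition majority_threshold :: "nat \<Rightarrow> nat" where
  "majority_threshold n = Suc (nat \<lfloor>real n / 2 + 2 * sqrt (real n)\<rfloor>)"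

text \<open>Phrased through the opposite value, so that a string in which neither value reaches the
  threshold is related to both outputs, as required of invalid inputs.\<close>

definition gap_majority :: "nat \<Rightarrow> (bool list \<times> bool) set" where
  "gap_majority n = {(x, b). x \<in> bits n \<and> count_list x (\<not> b) < majority_threshold n}"

lemma majority_threshold_bounds:
  "real n / 2 + 2 * sqrt (real n) < real (majority_threshold n)"
  "real (majority_threshold n) \<le> real n / 2 + 2 * sqrt (real n) + 1"
proof -
  define y where "y = real n / 2 + 2 * sqrt (real n)"
  have "0 \<le> y" by (simp add: y_def)
  then have "real (nat \<lfloor>y\<rfloor>) = of_int \<lfloor>y\<rfloor>" by simp
  then show "real n / 2 + 2 * sqrt (real n) < real (majority_threshold n)"
    "real (majority_threshold n) \<le> real n / 2 + 2 * sqrt (real n) + 1"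
    unfolding majority_threshold_def y_def[symmetric] of_nat_Suc by linarith+
qed

lemma less_double_majority_threshold: "n < 2 * majority_threshold n"
proof -
  have "0 \<le> sqrt (real n)" by simp
  then have "real n / 2 < real (majority_threshold n)"
    using majority_threshold_bounds(1)[of n] by linarith
  then show ?thesis by linarith
qed

lemma count_list_compl: "count_list x b + count_list x (\<not> b) = length x"
  by (induction x) auto

lemma signed_sum_count_list:
  "(\<Sum>j<length v. if v ! j = b then 1 else - 1 :: real) = 2 * real (count_list v b) - real (length v)"
  by (induction v) (auto simp: sum.lessThan_Suc_shift simp del: sum.lessThan_Suc)

text \<open>At most one of the two values can reach the threshold, because it exceeds
  \<open>n/2\<close>.\<close>

lemma preimage_gap_majority:
  "preimage (gap_majority n) b = {x \<in> bits n. majority_threshold n \<le> count_list x b}"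
proof -
  have "count_list x (\<not> b) < majority_threshold n"
    if "length x = n" "majority_threshold n \<le> count_list x b" for x
    using that less_double_majority_threshold[of n] count_list_compl[of x b] by linarith
  then show ?thesis by (auto simp: preimage_def gap_majority_def bits_def)
qed

lemma valid_inputs_gap_majority:
  "x \<in> valid_inputs (gap_majority n) \<longleftrightarrow> x \<in> bits n \<and> (\<exists>b. majority_threshold n \<le> count_list x b)"
  by (auto simp: valid_inputs_def preimage_gap_majority ex_bool_eq)

lemma pf_value_gap_majority:
  assumes "x \<in> bits n" "majority_threshold n \<le> count_list x b"
  shows "pf_value (gap_majority n) x = b"
proof -
  have "x \<in> preimage (gap_majority n) b" using assms by (simp add: preimage_gap_majority)
  then have "(x, c) \<in> gap_majority n \<longleftrightarrow> c = b" for c by (cases c; cases b) (auto simp: preimage_def)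
  then show ?thesis by (simp add: pf_value_def)
qed

lemma partial_boolean_function_gap_majority: "partial_boolean_function n (gap_majority n)"
  unfolding partial_boolean_function_def Ball_def Diff_iff valid_inputs_gap_majority
  by (auto simp: gap_majority_def not_le)

lemma close_rel_subset: "close_rel n \<subseteq> bits n \<times> bits n"
  by (auto simp: close_rel_def)

lemma bits_eq_listset: "bits n = listset (replicate n UNIV)"
  by (auto simp: bits_def mem_listset_iff)

lemma finite_bits: "finite (bits n)"
  unfolding bits_eq_listset by (rule finite_listset) auto

section \<open>Lower and upper bound for the relation\<close>

text \<open>The coordinates are independent with biases summing to at most
  \<open>sqrt n / 2\<close>, so success is a deviation of at least \<open>3/2 * sqrt n\<close>,
  which Chebyshev's inequality bounds by \<open>n / (9 * n / 4) = 4/9\<close>. The map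
  \<open>val\<close> is arbitrary so that coordinates may be single bits or whole blocks.\<close>

lemma card_close_le:
  fixes val :: "'a \<Rightarrow> bool"
  assumes n: "0 < n" "length Cs = n"
    and fin: "\<And>i. i < n \<Longrightarrow> finite (Cs ! i)"
    and \<beta>: "\<And>i. i < n \<Longrightarrow> \<bar>\<Sum>x\<in>Cs ! i. if val x then 1 else - 1 :: real\<bar> \<le> \<beta> i * real (card (Cs ! i))"
    and sum: "(\<Sum>i<n. \<beta> i) \<le> sqrt (real n) / 2"
  shows "real (card {xs \<in> listset Cs. (map val xs, a) \<in> close_rel n}) \<le> 4 / 9 * real (card (listset Cs))"
proof (cases "\<exists>i<n. Cs ! i = {}")
  case True
  then have "listset Cs = {}" using n by (force simp: mem_listset_iff)
  then show ?thesis by simp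
next
  case False
  define \<sigma> where "\<sigma> = (\<lambda>i x. if val x = a ! i then 1 else - 1 :: real)"
  \<comment> \<open>The mean agreement of coordinate \<open>i\<close> with the guess
    \<open>a ! i\<close>; the guess affects only the sign of the bias.\<close>
  define \<mu> where "\<mu> = (\<lambda>i. (\<Sum>x\<in>Cs ! i. \<sigma> i x) / real (card (Cs ! i)))"
  have pos: "0 < card (Cs ! i)" if "i < n" for i using that False fin by (auto simp: card_gt_0_iff)
  have \<mu>_le: "\<mu> i \<le> \<beta> i" if i: "i < n" for i
  proof -
    have "\<sigma> i x = (if a ! i then 1 else - 1) * (if val x then 1 else - 1)" for x
      by (simp add: \<sigma>_def)
    then have "(\<Sum>x\<in>Cs ! i. \<sigma> i x) \<le> \<beta> i * real (card (Cs ! i))"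
      using \<beta>[OF i] by (auto simp: abs_le_iff simp flip: sum_distrib_left)
    then show ?thesis using pos[OF i] by (simp add: \<mu>_def divide_le_eq)
  qed
  have "(3 / 2 * sqrt (real n))\<^sup>2 * real (card {xs \<in> listset Cs. (map val xs, a) \<in> close_rel n})
      \<le> real (length Cs) * real (card (listset Cs))"
  proof (rule uniform_product_Chebyshev[where \<sigma> = \<sigma> and \<mu> = \<mu>])
    fix xs assume xs: "xs \<in> listset Cs" "(map val xs, a) \<in> close_rel n"
    then have len: "length xs = n" using n by (simp add: mem_listset_iff)
    have "2 * sqrt (real n) \<le> (\<Sum>i<n. \<sigma> i (xs ! i))"
      using xs(2) len by (simp add: close_rel_def agreement_def \<sigma>_def)
    moreover have "(\<Sum>i<n. \<mu> i) \<le> sqrt (real n) / 2"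
      using sum_mono[of "{..<n}" \<mu> \<beta>] \<mu>_le sum by simp
    ultimately show "3 / 2 * sqrt (real n) \<le> \<bar>(\<Sum>i<length Cs. \<sigma> i (xs ! i)) - (\<Sum>i<length Cs. \<mu> i)\<bar>"
      unfolding n(2) by linarith
  qed (use n fin False pos in \<open>auto simp: \<mu>_def \<sigma>_def\<close>)
  then show ?thesis using n by (simp add: power_mult_distrib power2_eq_square)
qed

text \<open>Cylinders are products: the factor at \<open>j\<close> is full, a single bit, or empty
  if constraints contradict each other. Conditioning on a transcript therefore keeps the bits
  independent.\<close>

lemma bits_Int_cyl:
  assumes "fst ` L \<subseteq> {..<n}"
  shows "bits n \<inter> cyl L = listset (map (\<lambda>j. {b. \<forall>c. (j, c) \<in> L \<longrightarrow> b = c}) [0..<n])"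
proof -
  have "i < n" if "(i, c) \<in> L" for i c using that assms by force
  then show ?thesis by (auto simp: bits_def cyl_def mem_listset_iff)
qed

text \<open>A queried bit has bias at most one and an unqueried bit has bias zero, so the biases at
  a leaf sum to at most \<open>q\<close>. The resulting success rate \<open>4/9\<close> is below the
  required \<open>5/9\<close>.\<close>

lemma close_rel_lower:
  assumes n: "0 < n" and q: "real q \<le> sqrt (real n) / 2"
  shows "\<not> has_algorithm (4/9) n (close_rel n) q"
proof (rule not_has_algorithm_if_hard_set[where X = "bits n" and c = "4/9"])
  show "finite (bits n)" by (rule finite_bits)
  show "bits n \<noteq> {}" by (auto simp: bits_def intro: Ex_list_of_length)
  fix L :: "(nat \<times> bool) set" and s
  assume L: "finite L" "card L \<le> q" "fst ` L \<subseteq> {..<n}"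
  let ?C = "\<lambda>j. {b. \<forall>c. (j, c) \<in> L \<longrightarrow> b = c}"
  have "real (card {xs \<in> listset (map ?C [0..<n]). (map (\<lambda>b. b) xs, s) \<in> close_rel n})
      \<le> 4 / 9 * real (card (listset (map ?C [0..<n])))"
  proof (rule card_close_le[where \<beta> = "\<lambda>j. of_bool (j \<in> fst ` L)"])
    fix i assume i: "i < n"
    have "\<bar>\<Sum>x\<in>?C i. if x then 1 else - 1 :: real\<bar> \<le> of_bool (i \<in> fst ` L) * real (card (?C i))"
    proof (cases "i \<in> fst ` L")
      case True
      have "\<bar>\<Sum>x\<in>?C i. if x then 1 else - 1 :: real\<bar> \<le> (\<Sum>x\<in>?C i. \<bar>if x then 1 else - 1 :: real\<bar>)"
        by (rule sum_abs)
      also have "\<dots> = (\<Sum>x\<in>?C i. 1)" by (intro sum.cong) auto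
      finally show ?thesis using True by simp
    next
      case False
      then have "?C i = UNIV" by force
      then show ?thesis using False by (simp add: UNIV_bool)
    qed
    then show "\<bar>\<Sum>x\<in>map ?C [0..<n] ! i. if x then 1 else - 1 :: real\<bar>
      \<le> of_bool (i \<in> fst ` L) * real (card (map ?C [0..<n] ! i))" using i by simp
  next
    have "(\<Sum>i<n. of_bool (i \<in> fst ` L) :: real) = real (card (fst ` L))"
      using L(3) by (simp add: Int_absorb1 Int_commute Int_absorb2 flip: of_nat_sum)
    also have "\<dots> \<le> real q" using card_image_le[OF L(1), of fst] L(2) by simp
    finally show "(\<Sum>i<n. of_bool (i \<in> fst ` L)) \<le> sqrt (real n) / 2" using q by simp
  qed (use n in auto)
  then show "real (card {x \<in> bits n \<inter> cyl L. (x, s) \<in> close_rel n}) \<le> 4 / 9 * real (card (bits n \<inter> cyl L))"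
    unfolding bits_Int_cyl[OF L(3)] by simp
qed auto

text \<open>The first \<open>m\<close> bits are read and the others guessed. The expected agreement
  is \<open>m\<close>, at least \<open>4 * sqrt n\<close>, so a failure is a deviation by
  \<open>2 * sqrt n\<close> and has probability at most \<open>1/4\<close>.\<close>

lemma close_rel_upper:
  assumes m: "4 * sqrt (real n) \<le> real m" "m \<le> n" and n: "0 < n"
  shows "has_algorithm (4/9) n (close_rel n) m"
proof (rule has_algorithm_uniform_seed[where R = "bits n" and js = "\<lambda>_. [0..<m]" and F = "\<lambda>u bs. bs @ drop m u"])
  show "finite (bits n)" by (rule finite_bits)
  show "bits n \<noteq> {}" by (auto simp: bits_def intro: Ex_list_of_length)
  fix x assume x: "x \<in> bits n"
  \<comment> \<open>The first \<open>m\<close> bits of the seed are ignored; their positions always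
    count as agreements.\<close>
  define \<sigma> where "\<sigma> = (\<lambda>i b. if i < m \<or> x ! i = b then 1 else - 1 :: real)"
  let ?out = "\<lambda>u. map (\<lambda>i. x ! i) [0..<m] @ drop m u"
  have "(2 * sqrt (real n))\<^sup>2 * real (card {u \<in> listset (replicate n UNIV). (x, ?out u) \<notin> close_rel n})
      \<le> real (length (replicate n (UNIV :: bool set))) * real (card (listset (replicate n (UNIV :: bool set))))"
  proof (rule uniform_product_Chebyshev[where \<sigma> = \<sigma> and \<mu> = "\<lambda>i. of_bool (i < m)"])
    fix u :: "bool list"
    assume u: "u \<in> listset (replicate n UNIV)" "(x, ?out u) \<notin> close_rel n"
    then have len: "length u = n" by (simp add: mem_listset_iff)
    have "(if x ! i = ?out u ! i then 1 else - 1) = \<sigma> i (u ! i)" if "i < n" for i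
      using that len m by (auto simp: \<sigma>_def nth_append)
    then have "agreement x (?out u) = (\<Sum>i<n. \<sigma> i (u ! i))"
      using x by (simp add: agreement_def bits_def)
    moreover have "agreement x (?out u) < 2 * sqrt (real n)"
      using u(2) x len m by (auto simp: close_rel_def bits_def)
    moreover have "(\<Sum>i<n. of_bool (i < m) :: real) = real m"
    proof -
      have "{..<n} \<inter> {i. i < m} = {..<m}" using m(2) by auto
      then show ?thesis by simp
    qed
    ultimately show "2 * sqrt (real n) \<le> \<bar>(\<Sum>i<length (replicate n (UNIV :: bool set)). \<sigma> i (u ! i))
        - (\<Sum>i<length (replicate n (UNIV :: bool set)). of_bool (i < m))\<bar>"
      using m(1) by simp
  qed (auto simp: \<sigma>_def UNIV_bool)
  then have "4 * real (card {u \<in> bits n. (x, ?out u) \<notin> close_rel n}) \<le> real (card (bits n))"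
    using n by (simp add: power_mult_distrib flip: bits_eq_listset)
  then show "real (card {u \<in> bits n. (x, ?out u) \<notin> close_rel n}) \<le> 4 / 9 * real (card (bits n))"
    by simp
qed (use m in auto)

section \<open>Strings as concatenations of blocks, and the upper bound for the composition\<close>

lemma nth_concat_blocks:
  assumes "set xs \<subseteq> bits m" "i < length xs" "j < m"
  shows "concat xs ! (i * m + j) = xs ! i ! j"
  using assms
proof (induction xs arbitrary: i)
  case (Cons x xs)
  then show ?case by (cases i) (auto simp: bits_def nth_append)
qed simp

lemma length_concat_blocks: "set xs \<subseteq> bits m \<Longrightarrow> length (concat xs) = length xs * m"
  by (induction xs) (auto simp: bits_def)

lemma bits_mult_blocks:
  "x \<in> bits (n * m) \<Longrightarrow> \<exists>xs. length xs = n \<and> set xs \<subseteq> bits m \<and> x = concat xs"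
proof (induction n arbitrary: x)
  case (Suc n)
  then have "drop m x \<in> bits (n * m)" by (simp add: bits_def)
  then obtain xs where "length xs = n" "set xs \<subseteq> bits m" "drop m x = concat xs"
    using Suc.IH by blast
  then show ?case
    using Suc.prems append_take_drop_id[of m x]
    by (intro exI[of _ "take m x # xs"]) (auto simp: bits_def)
qed (simp add: bits_def)

lemma concat_blocks_inject:
  assumes "length xs = length ys" "set xs \<subseteq> bits m" "set ys \<subseteq> bits m" "concat xs = concat ys"
  shows "xs = ys"
  using assms(4,1)
proof (rule concat_injective)
  show "\<forall>(x, y)\<in>set (zip xs ys). length x = length y"
    using assms(2,3) by (fastforce simp: bits_def dest: set_zip_leftD set_zip_rightD)
qed

text \<open>Blocks of equal length are determined by their concatenation, which removes the
  existential quantifier over block lists from \<open>compose_rel\<close>.\<close>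

lemma compose_rel_concat_iff:
  assumes "length xs = n" "set xs \<subseteq> bits m"
  shows "(concat xs, s) \<in> compose_rel n m S f g \<longleftrightarrow>
    s \<in> S \<and> (set xs \<subseteq> valid_inputs g \<longrightarrow> (map (pf_value g) xs, s) \<in> f)"
proof -
  have "(concat xs, s) \<in> compose_rel n m S f g \<longleftrightarrow> s \<in> S \<and>
    ((\<exists>x\<in>set xs. x \<notin> valid_inputs g) \<or>
     (\<forall>x\<in>set xs. x \<in> valid_inputs g) \<and> (map (pf_value g) xs, s) \<in> f)" (is "?l \<longleftrightarrow> ?r")
  proof
    assume ?l
    then obtain ys where "length ys = n" "set ys \<subseteq> bits m" "concat xs = concat ys" and
      ys: "s \<in> S" "(\<exists>x\<in>set ys. x \<notin> valid_inputs g) \<or>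
        (\<forall>x\<in>set ys. x \<in> valid_inputs g) \<and> (map (pf_value g) ys, s) \<in> f"
      unfolding compose_rel_def by auto
    then have "ys = xs" using assms concat_blocks_inject[of xs ys m] by simp
    then show ?r using ys by simp
  next
    assume ?r
    then show ?l using assms unfolding compose_rel_def by auto
  qed
  then show ?thesis by auto
qed

text \<open>One uniformly random bit of each block serves as the guess for its value. On valid
  blocks the expected total agreement is at least \<open>4 * sqrt n\<close>, so a failure deviates
  by \<open>2 * sqrt n\<close> and has probability at most \<open>1/4\<close>.\<close>

lemma compose_upper:
  assumes n: "0 < n"
  shows "has_algorithm (1/3) (n * n) (compose_rel n n (bits n) (close_rel n) (gap_majority n)) n"
    (is "has_algorithm _ _ ?h _")
proof (rule has_algorithm_uniform_seed[where R = "listset (replicate n {..<n})"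
      and js = "\<lambda>r. map (\<lambda>i. i * n + r ! i) [0..<n]" and F = "\<lambda>_ bs. bs"])
  let ?R = "listset (replicate n {..<n})"
  show "finite ?R" by (rule finite_listset) auto
  have "replicate n 0 \<in> ?R" using n by (auto simp: mem_listset_iff)
  then show "?R \<noteq> {}" by blast
  show "set (map (\<lambda>i. i * n + r ! i) [0..<n]) \<subseteq> {..<n * n}" if r: "r \<in> ?R" for r
  proof -
    have "i * n + r ! i < n * n" if "i < n" for i
    proof -
      have "r ! i < n" using that r by (auto simp: mem_listset_iff)
      then have "i * n + r ! i < Suc i * n" by simp
      also have "\<dots> \<le> n * n" using that by (intro mult_le_mono1) simp
      finally show ?thesis .
    qed
    then show ?thesis by auto
  qed
  fix x assume "x \<in> bits (n * n)"
  then obtain xs where xs: "length xs = n" "set xs \<subseteq> bits n" "x = concat xs"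
    using bits_mult_blocks by blast
  let ?out = "\<lambda>r. map (\<lambda>i. x ! i) (map (\<lambda>i. i * n + r ! i) [0..<n])"
  have len: "?out r \<in> bits n" for r by (simp add: bits_def)
  have out: "?out r ! i = xs ! i ! (r ! i)" if "r \<in> ?R" "i < n" for r i
    using that xs nth_concat_blocks[OF xs(2), of i "r ! i"] by (auto simp: mem_listset_iff)
  show "real (card {r \<in> ?R. (x, ?out r) \<notin> ?h}) \<le> 1 / 3 * real (card ?R)"
  proof (cases "set xs \<subseteq> valid_inputs (gap_majority n)")
    case False
    \<comment> \<open>With an invalid block every string of length \<open>n\<close> is a correct
      answer.\<close>
    then have "{r \<in> ?R. (x, ?out r) \<notin> ?h} = {}"
      using len unfolding xs(3) compose_rel_concat_iff[OF xs(1,2)] by blast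
    then show ?thesis by (simp only: card.empty)
  next
    case True
    define v where "v = (\<lambda>i. pf_value (gap_majority n) (xs ! i))"
    have v: "majority_threshold n \<le> count_list (xs ! i) (v i)" if "i < n" for i
    proof -
      have "xs ! i \<in> valid_inputs (gap_majority n)" using that xs(1) True nth_mem by blast
      then show ?thesis unfolding valid_inputs_gap_majority v_def by (auto dest: pf_value_gap_majority)
    qed
    define \<sigma> where "\<sigma> = (\<lambda>i j. if xs ! i ! j = v i then 1 else - 1 :: real)"
    define \<mu> where "\<mu> = (\<lambda>i. (\<Sum>j<n. \<sigma> i j) / real n)"
    \<comment> \<open>The threshold \<open>n/2 + 2 * sqrt n\<close> leaves a surplus of at least
      \<open>4 * sqrt n\<close> right over wrong bits in a block.\<close>
    have \<mu>: "4 * sqrt (real n) / real n \<le> \<mu> i" if "i < n" for i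
    proof -
      have "length (xs ! i) = n" using that xs(1,2) nth_mem[of i xs] unfolding bits_def by blast
      then have "(\<Sum>j<n. \<sigma> i j) = 2 * real (count_list (xs ! i) (v i)) - real n"
        using signed_sum_count_list[of "xs ! i" "v i"] by (simp only: \<sigma>_def)
      also have "\<dots> \<ge> 4 * sqrt (real n)"
        using v[OF that] majority_threshold_bounds(1)[of n] by linarith
      finally show ?thesis unfolding \<mu>_def by (intro divide_right_mono) auto
    qed
    have "(\<Sum>i<n. 4 * sqrt (real n) / real n) \<le> (\<Sum>i<n. \<mu> i)"
      using \<mu> by (intro sum_mono) auto
    then have M: "4 * sqrt (real n) \<le> (\<Sum>i<n. \<mu> i)" using n by simp
    have "(2 * sqrt (real n))\<^sup>2 * real (card {r \<in> ?R. (x, ?out r) \<notin> ?h})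
        \<le> real (length (replicate n {..<n})) * real (card ?R)"
    proof (rule uniform_product_Chebyshev[where \<sigma> = \<sigma> and \<mu> = \<mu>])
      fix r assume r: "r \<in> ?R" "(x, ?out r) \<notin> ?h"
      have "agreement (map (pf_value (gap_majority n)) xs) (?out r)
          = (\<Sum>i<n. if v i = ?out r ! i then 1 else - 1)"
        using xs by (auto simp: agreement_def v_def intro!: sum.cong)
      also have "\<dots> = (\<Sum>i<n. \<sigma> i (r ! i))"
        using out[OF r(1)] by (intro sum.cong) (auto simp: \<sigma>_def)
      finally have "(\<Sum>i<n. \<sigma> i (r ! i)) < 2 * sqrt (real n)"
        using r(2) True len[of r] xs(1) unfolding xs(3) compose_rel_concat_iff[OF xs(1,2)]
        by (simp add: close_rel_def bits_def del: map_map)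
      then show "2 * sqrt (real n) \<le> \<bar>(\<Sum>i<length (replicate n {..<n}). \<sigma> i (r ! i))
          - (\<Sum>i<length (replicate n {..<n}). \<mu> i)\<bar>"
        using M by simp
    qed (use n in \<open>auto simp: \<sigma>_def \<mu>_def\<close>)
    then have "4 * real (card {r \<in> ?R. (x, ?out r) \<notin> ?h}) \<le> real (card ?R)"
      using n by (simp add: power_mult_distrib)
    then show ?thesis by simp
  qed
qed simp

section \<open>Lower bound for the composition\<close>

text \<open>By absorption \<open>N choose a\<close> is \<open>(a + 1) / (N + 1)\<close> times
  \<open>Suc N choose Suc a\<close>, so passing from \<open>Suc N\<close> to \<open>N\<close>
  multiplies the ratio by \<open>(b + 1) / (a + 1)\<close>, which is at least
  \<open>d\<close>.\<close>

lemma choose_step_chosen: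
  fixes c d :: real
  assumes "c * real (Suc N choose Suc a) \<le> real (Suc N choose Suc b)"
    and "d * real (Suc a) \<le> real (Suc b)" and "0 \<le> c" "0 \<le> d"
  shows "d * c * real (N choose a) \<le> real (N choose b)"
proof -
  have ab: "real (Suc N) * real (N choose j) = real (Suc j) * real (Suc N choose Suc j)" for j
    using arg_cong[OF binomial_absorption[of j "Suc N"], of real]
    by (simp add: algebra_simps del: binomial_Suc_Suc)
  have "real (Suc N) * (d * c * real (N choose a)) = (d * real (Suc a)) * (c * real (Suc N choose Suc a))"
    using ab[of a] by (simp add: algebra_simps)
  also have "\<dots> \<le> real (Suc b) * real (Suc N choose Suc b)"
    using assms by (intro mult_mono) auto
  also have "\<dots> = real (Suc N) * real (N choose b)" using ab[of b] by simp
  finally show ?thesis by (simp only: mult_le_cancel_left_pos of_nat_0_less_iff zero_less_Suc)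
qed

text \<open>Equality holds by symmetry when \<open>a + b = N\<close>. Each lowering of
  \<open>N\<close> with \<open>a\<close> and \<open>b\<close> fixed shrinks the coefficient with the
  larger lower index by the smaller factor.\<close>

lemma choose_le_choose_nearer_middle:
  "a + b = N + v \<Longrightarrow> b \<le> a \<Longrightarrow> N choose a \<le> N choose b"
proof (induction v arbitrary: N)
  case 0
  then have "N - b = a" "b \<le> N" by linarith+
  then show ?case using binomial_symmetric[of b N] by simp
next
  case (Suc v)
  have "Suc N * (N choose a) = (Suc N - a) * (Suc N choose a)"
    using binomial_absorb_comp[of "Suc N" a] by simp
  also have "\<dots> \<le> (Suc N - b) * (Suc N choose b)"
    using Suc by (intro mult_le_mono) auto
  also have "\<dots> = Suc N * (N choose b)"
    using binomial_absorb_comp[of "Suc N" b] by simp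
  finally show ?case by (simp only: mult_le_cancel1)
qed

lemma choose_ratio:
  fixes d :: real
  assumes "a + b + u = N + v" "b \<le> a" "0 \<le> d" "d \<le> 1" "d * real a \<le> real b"
  shows "d ^ u * real (N choose a) \<le> real (N choose b)"
  using assms(1,2,5)
proof (induction u arbitrary: N a b)
  case 0
  then show ?case using choose_le_choose_nearer_middle[of a b N v] by simp
next
  case (Suc u)
  have d: "d * real (Suc a) \<le> real (Suc b)"
    using Suc.prems(3) assms(4) by (simp add: algebra_simps)
  have "d ^ u * real (Suc N choose Suc a) \<le> real (Suc N choose Suc b)"
    using Suc.prems d by (intro Suc.IH) auto
  from choose_step_chosen[OF this d] assms(3) show ?case by simp
qed

text \<open>The coefficients count completions of a block to either value when \<open>u\<close>
  queried bits equal the first value and \<open>v\<close> the other. By symmetry the second is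
  \<open>m - (u + v) choose (m - k - u)\<close>. Its lower index falls short of \<open>k - u\<close>
  by \<open>2 * k - m\<close>, at most an \<open>\<eta>\<close> fraction, so
  \<open>choose_ratio\<close> applies with \<open>1 - \<eta>\<close>, and Bernoulli's inequality
  linearizes the power.\<close>

lemma choose_bias_one_sided:
  fixes \<eta> :: real
  assumes "m \<le> 2 * k" "u + v + k \<le> m" "0 \<le> \<eta>" "\<eta> \<le> 1"
    and "2 * real k - real m \<le> \<eta> * (real k - real (u + v))"
  shows "real (m - (u + v) choose (k - u)) - real (m - (u + v) choose (k - v))
       \<le> \<eta> * real (u + v) * real (m - (u + v) choose (k - u))"
proof -
  let ?A = "real (m - (u + v) choose (k - u))" and ?B = "real (m - (u + v) choose (m - k - u))"
  have uv: "u + v \<le> k" using assms(1,2) by linarith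
  have B: "?B = real (m - (u + v) choose (k - v))"
  proof -
    have "m - (u + v) - (k - v) = m - k - u" using assms(2) uv by linarith
    then show ?thesis using binomial_symmetric[of "k - v" "m - (u + v)"] assms(2) uv by simp
  qed
  have "(1 - \<eta>) ^ u * ?A \<le> ?B"
  proof (rule choose_ratio[where v = v])
    have "\<eta> * (real k - real (u + v)) \<le> \<eta> * real (k - u)"
      using assms(3) uv by (intro mult_left_mono) (auto simp: of_nat_diff)
    then have "2 * real k - real m \<le> \<eta> * real (k - u)" using assms(5) by linarith
    moreover have "real (k - u) - real (m - k - u) = 2 * real k - real m"
      using uv assms(2) by (simp add: of_nat_diff)
    ultimately show "(1 - \<eta>) * real (k - u) \<le> real (m - k - u)" by (simp add: left_diff_distrib)
  qed (use assms uv in auto)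
  moreover have "1 - real u * \<eta> \<le> (1 - \<eta>) ^ u"
    using Bernoulli_inequality[of "- \<eta>" u] assms(4) by simp
  then have "(1 - real u * \<eta>) * ?A \<le> (1 - \<eta>) ^ u * ?A" by (intro mult_right_mono) auto
  moreover have "real u * \<eta> * ?A \<le> \<eta> * real (u + v) * ?A"
    using assms(3) by (intro mult_right_mono) (auto simp: mult.commute[of _ \<eta>] intro: mult_left_mono)
  ultimately show ?thesis unfolding B[symmetric] by (simp add: left_diff_distrib)
qed

text \<open>Exchanging \<open>u\<close> and \<open>v\<close> exchanges \<open>A\<close> and
  \<open>B\<close>, so the one-sided bound controls both signs.\<close>

lemma choose_bias:
  fixes \<eta> :: real
  assumes "m \<le> 2 * k" "u + v + k \<le> m" "0 \<le> \<eta>" "\<eta> \<le> 1"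
    and "2 * real k - real m \<le> \<eta> * (real k - real (u + v))"
  defines "A \<equiv> real (m - (u + v) choose (k - u))" and "B \<equiv> real (m - (u + v) choose (k - v))"
  shows "\<bar>A - B\<bar> \<le> \<eta> * real (u + v) * (A + B)"
proof -
  have "A - B \<le> \<eta> * real (u + v) * A"
    using choose_bias_one_sided[of m k u v \<eta>] assms by simp
  moreover have "B - A \<le> \<eta> * real (u + v) * B"
    using choose_bias_one_sided[of m k v u \<eta>] assms by (simp add: add.commute)
  moreover have "0 \<le> \<eta> * real (u + v) * A" "0 \<le> \<eta> * real (u + v) * B"
    using assms(3) by (simp_all add: A_def B_def)
  ultimately show ?thesis by (simp add: distrib_left)
qed

section \<open>Bias of a block conditioned on a transcript\<close>

lemma count_list_eq_card: "count_list x b = card {i. i < length x \<and> x ! i = b}"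
proof -
  have "count_list x b = length (filter (\<lambda>c. c = b) x)" by (induction x) auto
  then show ?thesis by (simp add: length_filter_conv_card)
qed

text \<open>Such a string is determined by the set of unqueried positions that hold
  \<open>b\<close>, and every set of the right size occurs; \<open>enc\<close> and
  \<open>dec\<close> are the two directions of this bijection.\<close>

lemma card_cyl_weight:
  assumes L: "finite L" "fst ` L \<subseteq> {..<m}" and single: "\<And>i. (i, True) \<in> L \<Longrightarrow> (i, False) \<notin> L"
    and k: "card {i. (i, b) \<in> L} \<le> k"
  shows "card {x \<in> bits m \<inter> cyl L. count_list x b = k} = (m - card L) choose (k - card {i. (i, b) \<in> L})"
proof -
  let ?T = "{i. (i, b) \<in> L}"
  let ?free = "{..<m} - fst ` L"
  let ?\<R> = "{R. R \<subseteq> ?free \<and> card R = k - card ?T}"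
  let ?X = "{x \<in> bits m \<inter> cyl L. count_list x b = k}"
  \<comment> \<open>The final comparison with \<open>b\<close> turns membership into a bit: it is
    the identity for \<open>b = True\<close> and negation for \<open>b = False\<close>.\<close>
  define enc where "enc = (\<lambda>R. map (\<lambda>i. (if i \<in> fst ` L then (i, b) \<in> L else i \<in> R) = b) [0..<m])"
  define dec where "dec = (\<lambda>x. {i \<in> ?free. x ! i = b})"
  have T: "?T \<subseteq> fst ` L" by force
  have finT: "finite ?T" using T L(1) finite_subset by blast
  have "bij_betw enc ?\<R> ?X"
  proof (rule bij_betw_byWitness[where f' = dec])
    show "\<forall>R\<in>?\<R>. dec (enc R) = R" by (auto simp: dec_def enc_def)
    show "\<forall>x\<in>?X. enc (dec x) = x"
    proof
      fix x assume x: "x \<in> ?X"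
      have "((if i \<in> fst ` L then (i, b) \<in> L else i \<in> dec x) = b) = x ! i" if "i < m" for i
      proof (cases "i \<in> fst ` L")
        case True
        then obtain c where "(i, c) \<in> L" by force
        then have "x ! i = c" "(i, b) \<in> L \<longleftrightarrow> b = c"
          using x single[of i] by (cases b; cases c; auto simp: cyl_def)+
        then show ?thesis using True by auto
      next
        case False
        then show ?thesis using that by (auto simp: dec_def)
      qed
      then have "enc (dec x) = map (\<lambda>i. x ! i) [0..<m]"
        unfolding enc_def by (intro map_cong) (auto simp del: split_paired_All)
      also have "\<dots> = x" using x map_nth[of x] by (simp add: bits_def)
      finally show "enc (dec x) = x" .
    qed
    show "enc ` ?\<R> \<subseteq> ?X"
    proof
      fix x assume "x \<in> enc ` ?\<R>"
      then obtain R where R: "R \<subseteq> ?free" "card R = k - card ?T" "x = enc R" by auto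
      have len: "length x = m" by (simp add: R enc_def)
      have "x ! i = c" if "(i, c) \<in> L" for i c
      proof -
        have "i < m" "i \<in> fst ` L" using that L(2) by force+
        moreover have "(i, b) \<in> L \<longleftrightarrow> b = c" using that single[of i] by (cases b; cases c; auto)
        ultimately show ?thesis by (auto simp: R enc_def)
      qed
      then have "x \<in> cyl L" by (auto simp: cyl_def)
      moreover have "{i. i < length x \<and> x ! i = b} = ?T \<union> R"
      proof -
        have "x ! i = b \<longleftrightarrow> i \<in> ?T \<union> R" if "i < m" for i
          using that R(1) T by (auto simp: R(3) enc_def)
        then show ?thesis using R(1) T L(2) unfolding len by blast
      qed
      then have "count_list x b = card (?T \<union> R)" by (simp add: count_list_eq_card)
      then have "count_list x b = card ?T + card R"
        using R(1) T finT by (subst (asm) card_Un_disjoint) (auto intro: finite_subset[OF R(1)])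
      ultimately show "x \<in> ?X" using R(2) k len by (simp add: bits_def)
    qed
    show "dec ` ?X \<subseteq> ?\<R>"
    proof
      fix R assume "R \<in> dec ` ?X"
      then obtain x where x: "x \<in> ?X" "R = dec x" by auto
      have "{i. i < length x \<and> x ! i = b} = ?T \<union> R"
      proof -
        have "x ! i = b \<longleftrightarrow> (i, b) \<in> L" if i: "i \<in> fst ` L" for i
        proof -
          obtain c where "(i, c) \<in> L" using i by force
          then show ?thesis using x single[of i] by (cases b; cases c; auto simp: cyl_def)
        qed
        then have "i < m \<and> x ! i = b \<longleftrightarrow> i \<in> ?T \<union> R" for i
          using T L(2) by (cases "i \<in> fst ` L") (auto simp: x(2) dec_def)
        then show ?thesis using x(1) unfolding bits_def by blast
      qed
      then have "k = card (?T \<union> R)" using x by (simp add: count_list_eq_card)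
      also have "\<dots> = card ?T + card R"
        using x T finT by (intro card_Un_disjoint) (auto simp: dec_def)
      finally show "R \<in> ?\<R>" using x by (auto simp: dec_def)
    qed
  qed
  then have "card ?X = card ?\<R>" by (rule bij_betw_same_card[symmetric])
  also have "\<dots> = card ?free choose (k - card ?T)" by (intro n_subsets) auto
  also have "card ?free = m - card (fst ` L)" using L by (subst card_Diff_subset) auto
  also have "card (fst ` L) = card L"
  proof (rule card_image, rule inj_onI)
    fix p p' assume "p \<in> L" "p' \<in> L" "fst p = fst p'"
    then show "p = p'" using single[of "fst p"] by (cases p; cases p'; cases "snd p"; cases "snd p'") auto
  qed
  finally show ?thesis .
qed

text \<open>The support of the hard block distribution: with \<open>k\<close> the promise threshold
  these are the valid blocks closest to balanced, and without queries both values are equally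
  likely.\<close>

definition exact_blocks :: "nat \<Rightarrow> nat \<Rightarrow> bool list set" where
  "exact_blocks m k = {x \<in> bits m. \<exists>b. count_list x b = k}"

text \<open>The positive and negative terms count completions of the transcript to \<open>k\<close>
  bits \<open>True\<close> and to \<open>k\<close> bits \<open>False\<close>. Both counts are
  binomial coefficients by \<open>card_cyl_weight\<close>, and \<open>choose_bias\<close> compares
  them.\<close>

lemma exact_blocks_bias:
  fixes \<eta> :: real
  assumes L: "finite L" "fst ` L \<subseteq> {..<m}"
    and k: "m < 2 * k" "card L + k \<le> m" and \<eta>: "0 \<le> \<eta>" "\<eta> \<le> 1"
    and d: "2 * real k - real m \<le> \<eta> * (real k - real (card L))"
  shows "\<bar>\<Sum>x\<in>exact_blocks m k \<inter> cyl L. if count_list x True = k then 1 else - 1 :: real\<bar>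
     \<le> \<eta> * real (card L) * real (card (exact_blocks m k \<inter> cyl L))"
proof (cases "\<exists>i. (i, True) \<in> L \<and> (i, False) \<in> L")
  case True
  then obtain i where i: "(i, True) \<in> L" "(i, False) \<in> L" by blast
  have "x \<notin> cyl L" for x
  proof
    assume "x \<in> cyl L"
    then have "x ! i = True" "x ! i = False" using i unfolding cyl_def by blast+
    then show False by simp
  qed
  then have "cyl L = {}" by blast
  then show ?thesis by simp
next
  case False
  let ?X = "\<lambda>b. {x \<in> bits m \<inter> cyl L. count_list x b = k}"
  let ?T = "\<lambda>b. {i. (i, b) \<in> L}"
  have fin: "finite (?X b)" for b using finite_bits[of m] by simp
  have disj: "?X True \<inter> ?X False = {}"
  proof -
    have "count_list x False \<noteq> k" if "length x = m" "count_list x True = k" for x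
      using that k(1) count_list_compl[of x True] by auto
    then show ?thesis by (auto simp: bits_def)
  qed
  have un: "exact_blocks m k \<inter> cyl L = ?X True \<union> ?X False"
    by (auto simp: exact_blocks_def ex_bool_eq)
  have "L = (\<lambda>i. (i, True)) ` ?T True \<union> (\<lambda>i. (i, False)) ` ?T False"
  proof (intro equalityI subsetI)
    fix p assume "p \<in> L"
    then show "p \<in> (\<lambda>i. (i, True)) ` ?T True \<union> (\<lambda>i. (i, False)) ` ?T False"
      by (cases p; cases "snd p") auto
  qed auto
  moreover have finT: "finite (?T b)" for b
    by (rule finite_subset[OF _ finite_imageI[OF L(1), of fst]]) force
  have "card ((\<lambda>i. (i, True)) ` ?T True \<union> (\<lambda>i. (i, False)) ` ?T False) = card (?T True) + card (?T False)"
    using finT by (subst card_Un_disjoint) (auto simp: card_image inj_on_def)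
  ultimately have cL: "card L = card (?T True) + card (?T False)" by simp
  have c: "card (?X b) = (m - card L) choose (k - card (?T b))" for b
    using L False cL k by (intro card_cyl_weight) (cases b; auto)+
  have diff: "(\<Sum>x\<in>exact_blocks m k \<inter> cyl L. if count_list x True = k then 1 else - 1 :: real)
      = (\<Sum>x\<in>?X True. 1) + (\<Sum>x\<in>?X False. - 1)"
  proof -
    have "count_list x True \<noteq> k" if "x \<in> ?X False" for x using that disj by blast
    then have no: "(\<Sum>x\<in>?X False. if count_list x True = k then 1 else - 1 :: real) = (\<Sum>x\<in>?X False. - 1)"
      by (intro sum.cong) auto
    have yes: "(\<Sum>x\<in>?X True. if count_list x True = k then 1 else - 1 :: real) = (\<Sum>x\<in>?X True. 1)"
      by (intro sum.cong) auto
    show ?thesis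
      unfolding un sum.union_disjoint[OF fin fin disj] by (rule arg_cong2[where f = "(+)", OF yes no])
  qed
  have total: "card (exact_blocks m k \<inter> cyl L) = card (?X True) + card (?X False)"
    unfolding un using fin disj by (intro card_Un_disjoint) auto
  have "\<bar>real (card (?X True)) - real (card (?X False))\<bar>
      \<le> \<eta> * real (card L) * (real (card (?X True)) + real (card (?X False)))"
    unfolding c cL using k d \<eta> unfolding cL by (intro choose_bias) auto
  then show ?thesis unfolding diff total by simp
qed

section \<open>Hard inputs for the composition\<close>

text \<open>At a leaf with at most \<open>n/48\<close> answers the block biases sum to at most
  \<open>24 / sqrt n * (n/48) = sqrt n / 2\<close>, the budget of \<open>card_close_le\<close>. The
  resulting success rate \<open>4/9\<close> is below \<open>2/3\<close>.\<close>

lemma compose_lower: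
  assumes n: "576 \<le> n" and q: "real q \<le> real n / 48"
  shows "\<not> has_algorithm (1/3) (n * n) (compose_rel n n (bits n) (close_rel n) (gap_majority n)) q"
    (is "\<not> has_algorithm _ _ ?h _")
proof -
  define k where "k = majority_threshold n"
  define r where "r = sqrt (real n)"
  \<comment> \<open>The gap \<open>2 * k - n\<close> is at most \<open>6 * r\<close> and
    \<open>k - q\<close> is at least \<open>n/4\<close>, so their ratio is at most
    \<open>24 / r\<close>; \<open>576 \<le> n\<close> makes this at most one.\<close>
  define \<eta> where "\<eta> = 24 / r"
  have rr: "r * r = real n" by (simp add: r_def)
  have "sqrt 576 \<le> r" unfolding r_def using n by (intro real_sqrt_le_mono) linarith
  moreover have "sqrt 576 = (24 :: real)" using real_sqrt_abs[of 24] by simp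
  ultimately have r: "24 \<le> r" by simp
  then have "24 * r \<le> r * r" by (intro mult_right_mono) auto
  then have rn: "24 * r \<le> real n" using rr by simp
  have k_bounds: "real n / 2 + 2 * r \<le> real k" "real k \<le> real n / 2 + 2 * r + 1"
    using majority_threshold_bounds[of n] by (auto simp: k_def r_def)
  \<comment> \<open>Room for the binomial counts remains even if all \<open>q\<close> queries fall
    into one block.\<close>
  have kn: "q + k \<le> n" using k_bounds(2) rn q r by linarith
  have \<eta>: "0 \<le> \<eta>" "\<eta> \<le> 1" using r by (auto simp: \<eta>_def)
  have d: "2 * real k - real n \<le> \<eta> * (real k - real q)"
  proof -
    have "2 * real k - real n \<le> 6 * r" using k_bounds(2) r by linarith
    also have "\<dots> = \<eta> * (real n / 4)" using r unfolding \<eta>_def rr[symmetric] by simp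
    also have "\<dots> \<le> \<eta> * (real k - real q)"
      using k_bounds(1) q r by (intro mult_left_mono \<eta>) linarith
    finally show ?thesis .
  qed
  have k2: "n < 2 * k" unfolding k_def by (rule less_double_majority_threshold)
  let ?V = "exact_blocks n k"
  let ?X = "concat ` listset (replicate n ?V)"
  have finV: "finite ?V" using finite_bits[of n] by (simp add: exact_blocks_def)
  have block: "length xs = n \<and> set xs \<subseteq> ?V" if "xs \<in> listset (replicate n ?V)" for xs
    using that by (auto simp: mem_listset_iff in_set_conv_nth)
  have Vbits: "?V \<subseteq> bits n" by (auto simp: exact_blocks_def)
  have valid: "x \<in> valid_inputs (gap_majority n)" "pf_value (gap_majority n) x = (count_list x True = k)"
    if "x \<in> ?V" for x
  proof -
    obtain b where b: "x \<in> bits n" "count_list x b = k" using \<open>x \<in> ?V\<close> by (auto simp: exact_blocks_def)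
    then show "x \<in> valid_inputs (gap_majority n)" 
      unfolding valid_inputs_gap_majority k_def[symmetric] by (auto intro: exI[of _ b])
    have "pf_value (gap_majority n) x = b" using b by (intro pf_value_gap_majority) (auto simp: k_def)
    moreover have "count_list x True = k \<longleftrightarrow> b"
      using b k2 count_list_compl[of x True] by (cases b) (auto simp: bits_def)
    ultimately show "pf_value (gap_majority n) x = (count_list x True = k)" by simp
  qed
  show ?thesis
  proof (rule not_has_algorithm_if_hard_set[where X = ?X and c = "4/9"])
    show "finite ?X" using finV by (intro finite_imageI finite_listset) auto
    have "count_list (replicate k True @ replicate (n - k) False) True = k"
      by (simp add: count_list_eq_length_filter)
    then have "replicate k True @ replicate (n - k) False \<in> ?V"
      using kn unfolding exact_blocks_def bits_def by (intro CollectI conjI exI[of _ True]) auto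
    then have "replicate n (replicate k True @ replicate (n - k) False) \<in> listset (replicate n ?V)"
      by (auto simp: mem_listset_iff)
    then show "?X \<noteq> {}" by blast
    show "?X \<subseteq> bits (n * n)"
    proof
      fix x assume "x \<in> ?X"
      then obtain xs where "x = concat xs" "length xs = n" "set xs \<subseteq> bits n"
        using block Vbits by blast
      then show "x \<in> bits (n * n)" using length_concat_blocks[of xs n] by (simp add: bits_def)
    qed
    fix L :: "(nat \<times> bool) set" and s
    assume L: "finite L" "card L \<le> q" "fst ` L \<subseteq> {..<n * n}"
    \<comment> \<open>Restricting the transcript to blocks makes its cylinder a product of block
      cylinders.\<close>
    define blk where "blk = (\<lambda>i. {(j, b). j < n \<and> (i * n + j, b) \<in> L})"
    let ?C = "\<lambda>i. ?V \<inter> cyl (blk i)"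
    let ?P = "listset (map ?C [0..<n])"
    have finP: "finite ?P" using finV by (intro finite_listset) auto
    have P_sub: "?P \<subseteq> listset (replicate n ?V)" by (auto simp: mem_listset_iff)
    have inj: "inj_on concat (listset (replicate n ?V))"
      using block Vbits by (intro inj_onI concat_blocks_inject[of _ _ n]) auto
    have cyl_iff: "concat xs \<in> cyl L \<longleftrightarrow> xs \<in> ?P" if xs: "xs \<in> listset (replicate n ?V)" for xs
    proof -
      have nth: "concat xs ! (i * n + j) = xs ! i ! j" if "i < n" "j < n" for i j
        using that block[OF xs] Vbits by (intro nth_concat_blocks[of _ n]) auto
      have "concat xs \<in> cyl L \<longleftrightarrow> (\<forall>i<n. xs ! i \<in> cyl (blk i))"
      proof
        assume "concat xs \<in> cyl L"
        then show "\<forall>i<n. xs ! i \<in> cyl (blk i)" using nth by (force simp: cyl_def blk_def)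
      next
        assume *: "\<forall>i<n. xs ! i \<in> cyl (blk i)"
        have "concat xs ! p = b" if p: "(p, b) \<in> L" for p b
        proof -
          have "p < n * n" using p L(3) by force
          then have i: "p div n < n" by (simp add: less_mult_imp_div_less)
          have j: "p mod n < n" using n by simp
          have "(p mod n, b) \<in> blk (p div n)" using p j by (simp add: blk_def)
          then have "xs ! (p div n) ! (p mod n) = b" using * i by (auto simp: cyl_def)
          then show ?thesis using nth[OF i j] by simp
        qed
        then show "concat xs \<in> cyl L" by (auto simp: cyl_def)
      qed
      then show ?thesis using xs by (auto simp: mem_listset_iff)
    qed
    have X_cyl: "?X \<inter> cyl L = concat ` ?P" using cyl_iff P_sub by blast
    have finblk: "finite (blk i)" for i
    proof (rule finite_imageD)
      show "finite ((\<lambda>(j, b). (i * n + j, b)) ` blk i)"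
        by (rule finite_subset[OF _ L(1)]) (auto simp: blk_def)
    qed (auto simp: inj_on_def)
    have sum_blk: "(\<Sum>i<n. card (blk i)) \<le> card L"
    proof -
      have "(\<Sum>i<n. card (blk i)) = card (SIGMA i:{..<n}. blk i)" using finblk by simp
      also have "\<dots> \<le> card L"
      proof (rule card_inj_on_le[where f = "\<lambda>(i, j, b). (i * n + j, b)"])
        show "inj_on (\<lambda>(i, j, b). (i * n + j, b)) (SIGMA i:{..<n}. blk i)"
        proof (rule inj_onI, clarsimp simp: blk_def)
          fix i j i' j' :: nat
          assume *: "j < n" "j' < n" "i * n + j = i' * n + j'"
          have "(i * n + j) div n = i" "(i' * n + j') div n = i'"
            "(i * n + j) mod n = j" "(i' * n + j') mod n = j'" using *(1,2) by auto
          then show "i = i' \<and> j = j'" using *(3) by simp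
        qed
      qed (auto simp: blk_def L(1))
      finally show ?thesis .
    qed
    have "card (blk i) \<le> card L" if "i < n" for i
      using sum_blk member_le_sum[of i "{..<n}" "\<lambda>i. card (blk i)"] that by simp
    then have cblk: "card (blk i) \<le> q" if "i < n" for i using that L(2) by fastforce
    have "real (card {xs \<in> ?P. (map (\<lambda>x. count_list x True = k) xs, s) \<in> close_rel n}) \<le> 4 / 9 * real (card ?P)"
    proof (rule card_close_le[where \<beta> = "\<lambda>i. \<eta> * real (card (blk i))"])
      fix i assume i: "i < n"
      have "\<bar>\<Sum>x\<in>?C i. if count_list x True = k then 1 else - 1 :: real\<bar> \<le> \<eta> * real (card (blk i)) * real (card (?C i))"
      proof (rule exact_blocks_bias)
        have "\<eta> * (real k - real q) \<le> \<eta> * (real k - real (card (blk i)))"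
          using cblk[OF i] \<eta> by (intro mult_left_mono) auto
        then show "2 * real k - real n \<le> \<eta> * (real k - real (card (blk i)))" using d by linarith
        show "card (blk i) + k \<le> n" using cblk[OF i] kn by linarith
      qed (use k2 \<eta> finblk in \<open>auto simp: blk_def\<close>)
      then show "\<bar>\<Sum>x\<in>map ?C [0..<n] ! i. if count_list x True = k then 1 else - 1 :: real\<bar>
        \<le> \<eta> * real (card (blk i)) * real (card (map ?C [0..<n] ! i))" using i by simp
    next
      have "real (\<Sum>i<n. card (blk i)) \<le> real n / 48" using sum_blk L(2) q by linarith
      then have "\<eta> * real (\<Sum>i<n. card (blk i)) \<le> \<eta> * (real n / 48)" by (intro mult_left_mono \<eta>)
      also have "\<dots> = r / 2" using r unfolding \<eta>_def rr[symmetric] by simp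
      finally show "(\<Sum>i<n. \<eta> * real (card (blk i))) \<le> sqrt (real n) / 2"
        by (simp add: sum_distrib_left r_def)
    qed (use n finV in auto)
    \<comment> \<open>All blocks are valid here, so a correct \<open>s\<close> for the composition
      is correct for the relation on the block values.\<close>
    moreover have "{x \<in> ?X \<inter> cyl L. (x, s) \<in> ?h}
        \<subseteq> concat ` {xs \<in> ?P. (map (\<lambda>x. count_list x True = k) xs, s) \<in> close_rel n}"
    proof
      fix x assume "x \<in> {x \<in> ?X \<inter> cyl L. (x, s) \<in> ?h}"
      then obtain xs where xs: "xs \<in> ?P" "x = concat xs" "(concat xs, s) \<in> ?h"
        unfolding X_cyl by auto
      have bl: "length xs = n" "set xs \<subseteq> ?V" using block P_sub xs(1) by blast+
      have "set xs \<subseteq> bits n" "set xs \<subseteq> valid_inputs (gap_majority n)"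
        using bl(2) Vbits valid(1) by blast+
      then have "(map (pf_value (gap_majority n)) xs, s) \<in> close_rel n"
        using iffD1[OF compose_rel_concat_iff[OF bl(1)] xs(3)] by blast
      moreover have "map (pf_value (gap_majority n)) xs = map (\<lambda>x. count_list x True = k) xs"
        using bl valid(2) by auto
      ultimately show "x \<in> concat ` {xs \<in> ?P. (map (\<lambda>x. count_list x True = k) xs, s) \<in> close_rel n}"
        using xs by auto
    qed
    then have "card {x \<in> ?X \<inter> cyl L. (x, s) \<in> ?h}
        \<le> card (concat ` {xs \<in> ?P. (map (\<lambda>x. count_list x True = k) xs, s) \<in> close_rel n})"
      by (rule card_mono[rotated]) (simp add: finP)
    moreover have "\<dots> \<le> card {xs \<in> ?P. (map (\<lambda>x. count_list x True = k) xs, s) \<in> close_rel n}"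
      by (rule card_image_le) (simp add: finP)
    moreover have "card (?X \<inter> cyl L) = card ?P"
      unfolding X_cyl by (rule card_image[OF inj_on_subset[OF inj P_sub]])
    ultimately show "real (card {x \<in> ?X \<inter> cyl L. (x, s) \<in> ?h}) \<le> 4 / 9 * real (card (?X \<inter> cyl L))"
      by linarith
  qed simp
qed

section \<open>Query complexity of the gap majority function\<close>

text \<open>The probability of outcome \<open>c\<close> for a bit that equals \<open>b\<close> with
  probability \<open>(1 + e) / 2\<close>.\<close>

definition coin :: "real \<Rightarrow> bool \<Rightarrow> bool \<Rightarrow> real" where
  "coin e b c = (1 + (if c = b then e else - e)) / 2"

definition biased_mass :: "real \<Rightarrow> bool \<Rightarrow> nat \<Rightarrow> bool list set \<Rightarrow> real" where
  "biased_mass e b k S = (\<Sum>x\<in>bits k \<inter> S. prod_list (map (coin e b) x))"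

lemma coin_nonneg: "\<bar>e\<bar> \<le> 1 \<Longrightarrow> 0 \<le> coin e b c"
  by (auto simp: coin_def)

lemma coin_sum: "(\<Sum>c\<in>UNIV. coin e b c) = 1"
  by (cases b) (auto simp: coin_def UNIV_bool field_simps)

lemma prod_list_coin_nonneg: "\<bar>e\<bar> \<le> 1 \<Longrightarrow> 0 \<le> prod_list (map (coin e b) x)"
  by (induction x) (auto intro: mult_nonneg_nonneg coin_nonneg)

lemma biased_mass_nonneg: "\<bar>e\<bar> \<le> 1 \<Longrightarrow> 0 \<le> biased_mass e b k S"
  unfolding biased_mass_def by (intro sum_nonneg prod_list_coin_nonneg)

lemma biased_mass_Un:
  "S \<inter> T = {} \<Longrightarrow> biased_mass e b k (S \<union> T) = biased_mass e b k S + biased_mass e b k T"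
  unfolding biased_mass_def using finite_bits[of k]
  by (subst sum.union_disjoint[symmetric]) (auto simp: Int_Un_distrib)

lemma biased_mass_cyl:
  assumes "fst ` L \<subseteq> {..<k}"
  shows "biased_mass e b k (cyl L) = (\<Prod>j<k. \<Sum>c | \<forall>d. (j, d) \<in> L \<longrightarrow> c = d. coin e b c)"
  unfolding biased_mass_def bits_Int_cyl[OF assms] sum_listset_prod_list by simp

lemma biased_mass_UNIV: "biased_mass e b k UNIV = 1"
  using biased_mass_cyl[of "{}" k e b] by (simp add: cyl_def coin_sum)

text \<open>In the product formula only the factor at \<open>i\<close> changes, from the full sum,
  which is one, to a single coin probability.\<close>

lemma biased_mass_cyl_insert:
  assumes L: "fst ` L \<subseteq> {..<k}" and i: "i < k" "i \<notin> fst ` L"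
  shows "biased_mass e b k (cyl (insert (i, c) L)) = coin e b c * biased_mass e b k (cyl L)"
proof -
  let ?Z = "\<lambda>L j. \<Sum>c | \<forall>d. (j, d) \<in> L \<longrightarrow> c = d. coin e b c"
  have none: "(i, d) \<notin> L" for d using i(2) by force
  have "biased_mass e b k (cyl (insert (i, c) L)) = (\<Prod>j<k. ?Z (insert (i, c) L) j)"
    using L i by (intro biased_mass_cyl) auto
  also have "\<dots> = ?Z (insert (i, c) L) i * (\<Prod>j\<in>{..<k} - {i}. ?Z (insert (i, c) L) j)"
    using i by (intro prod.remove) auto
  also have "?Z (insert (i, c) L) i = coin e b c" using none by simp
  also have "(\<Prod>j\<in>{..<k} - {i}. ?Z (insert (i, c) L) j) = (\<Prod>j\<in>{..<k} - {i}. ?Z L j)"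
    by (intro prod.cong) auto
  also have "\<dots> = ?Z L i * (\<Prod>j\<in>{..<k} - {i}. ?Z L j)" using none by (simp add: coin_sum)
  also have "\<dots> = (\<Prod>j<k. ?Z L j)" using i by (intro prod.remove[symmetric]) auto
  also have "\<dots> = biased_mass e b k (cyl L)" using L by (intro biased_mass_cyl[symmetric])
  finally show ?thesis .
qed

text \<open>The Cauchy-Schwarz inequality in dimension two.\<close>

lemma sqrt_mult_add_le:
  fixes a b c d :: real
  assumes "0 \<le> a" "0 \<le> b" "0 \<le> c" "0 \<le> d"
  shows "sqrt (a * b) + sqrt (c * d) \<le> sqrt ((a + c) * (b + d))"
proof (rule real_le_rsqrt)
  have "2 * sqrt ((a * d) * (c * b)) \<le> a * d + c * b"
    using arith_geo_mean_sqrt[of "a * d" "c * b"] assms by simp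
  moreover have "sqrt (a * b) * sqrt (c * d) = sqrt ((a * d) * (c * b))"
    by (simp add: real_sqrt_mult ac_simps)
  ultimately show "(sqrt (a * b) + sqrt (c * d))\<^sup>2 \<le> (a + c) * (b + d)"
    using assms by (simp add: power2_sum algebra_simps)
qed

text \<open>The share of the event \<open>S\<close> in the Bhattacharyya coefficient of the two
  product measures. Summed over the leaves of a tree it gives the coefficient of the transcript
  distributions.\<close>

definition bhattacharyya :: "real \<Rightarrow> nat \<Rightarrow> bool list set \<Rightarrow> real" where
  "bhattacharyya e k S = sqrt (biased_mass e True k S * biased_mass e False k S)"

lemma bhattacharyya_nonneg: "\<bar>e\<bar> \<le> 1 \<Longrightarrow> 0 \<le> bhattacharyya e k S"
  by (simp add: bhattacharyya_def biased_mass_nonneg)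

lemma bhattacharyya_superadditive:
  assumes "\<bar>e\<bar> \<le> 1" "S \<inter> T = {}"
  shows "bhattacharyya e k S + bhattacharyya e k T \<le> bhattacharyya e k (S \<union> T)"
  unfolding bhattacharyya_def biased_mass_Un[OF assms(2)]
  by (intro sqrt_mult_add_le biased_mass_nonneg assms(1))

text \<open>A fresh query gives each answer the factor \<open>sqrt ((1 - e^2) / 4)\<close>, and the
  two answers together \<open>sqrt (1 - e^2)\<close>. A repeated query loses nothing.\<close>

lemma bhattacharyya_query:
  assumes e: "\<bar>e\<bar> \<le> 1" and L: "fst ` L \<subseteq> {..<k}" and i: "i < k"
  shows "sqrt (1 - e\<^sup>2) * bhattacharyya e k (cyl L)
    \<le> bhattacharyya e k (cyl (insert (i, True) L)) + bhattacharyya e k (cyl (insert (i, False) L))"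
proof (cases "i \<in> fst ` L")
  case True
  then obtain c where "(i, c) \<in> L" by force
  then have "insert (i, c) L = L" by blast
  then have "bhattacharyya e k (cyl L) \<le>
      bhattacharyya e k (cyl (insert (i, True) L)) + bhattacharyya e k (cyl (insert (i, False) L))"
    using bhattacharyya_nonneg[OF e, of k] by (cases c) auto
  moreover have "sqrt (1 - e\<^sup>2) * bhattacharyya e k (cyl L) \<le> bhattacharyya e k (cyl L)"
    using bhattacharyya_nonneg[OF e, of k] by (intro mult_left_le_one_le) (auto simp: abs_square_le_1 e)
  ultimately show ?thesis by linarith
next
  case False
  have "bhattacharyya e k (cyl (insert (i, c) L)) = sqrt (1 - e\<^sup>2) / 2 * bhattacharyya e k (cyl L)" for c
  proof -
    have "coin e True c * coin e False c = (1 - e\<^sup>2) / 4"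
      by (cases c) (auto simp: coin_def power2_eq_square algebra_simps)
    then have "biased_mass e True k (cyl (insert (i, c) L)) * biased_mass e False k (cyl (insert (i, c) L))
        = (1 - e\<^sup>2) / 4 * (biased_mass e True k (cyl L) * biased_mass e False k (cyl L))"
      unfolding biased_mass_cyl_insert[OF L i False] by (simp add: ac_simps)
    then have "bhattacharyya e k (cyl (insert (i, c) L)) = sqrt ((1 - e\<^sup>2) / 4) * bhattacharyya e k (cyl L)"
      unfolding bhattacharyya_def by (simp only: real_sqrt_mult)
    then show ?thesis by (simp add: real_sqrt_divide)
  qed
  from this[of True] this[of False] show ?thesis by simp
qed

text \<open>Each query costs at most the factor from \<open>bhattacharyya_query\<close>, and
  superadditivity merges subtrees with the same output.\<close>

lemma bhattacharyya_tree:
  assumes e: "\<bar>e\<bar> \<le> 1" and L: "fst ` L \<subseteq> {..<k}" and t: "queried_indices t \<subseteq> {..<k}"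
    and d: "\<And>x. x \<in> bits k \<inter> cyl L \<Longrightarrow> query_count t x \<le> d"
  shows "sqrt (1 - e\<^sup>2) ^ d * bhattacharyya e k (cyl L)
    \<le> bhattacharyya e k {x \<in> cyl L. run t x} + bhattacharyya e k {x \<in> cyl L. \<not> run t x}"
  using L t d
proof (induction t arbitrary: L d)
  case (Output s)
  have "sqrt (1 - e\<^sup>2) ^ d \<le> 1" using e by (intro power_le_one) (auto simp: abs_square_le_1)
  then have "sqrt (1 - e\<^sup>2) ^ d * bhattacharyya e k (cyl L) \<le> bhattacharyya e k (cyl L)"
    using bhattacharyya_nonneg[OF e, of k "cyl L"] e
    by (intro mult_left_le_one_le) (auto simp: abs_square_le_1)
  moreover have "{x \<in> cyl L. run (Output s) x} = cyl L \<or> {x \<in> cyl L. \<not> run (Output s) x} = cyl L"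
    by auto
  ultimately show ?case
    using bhattacharyya_nonneg[OF e, of k "{x \<in> cyl L. run (Output s) x}"]
      bhattacharyya_nonneg[OF e, of k "{x \<in> cyl L. \<not> run (Output s) x}"] by (elim disjE) auto
next
  case (Query i t0 t1)
  show ?case
  \<comment> \<open>An empty cylinder would allow \<open>d = 0\<close> although a query
    follows.\<close>
  proof (cases "bits k \<inter> cyl L = {}")
    case True
    then have "bhattacharyya e k (cyl L) = 0" by (simp add: bhattacharyya_def biased_mass_def)
    then show ?thesis using bhattacharyya_nonneg[OF e] by simp
  next
    case False
    then obtain d' where d': "d = Suc d'" using Query.prems(3) by (cases d) fastforce+
    define sub where "sub = (\<lambda>b. if b then t1 else t0)"
    let ?L = "\<lambda>b. insert (i, b) L"
    let ?r = "sqrt (1 - e\<^sup>2)"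
    have r: "0 \<le> ?r ^ d'" using e by (simp add: abs_square_le_1)
    have i: "i < k" and L': "fst ` ?L b \<subseteq> {..<k}" for b using Query.prems(1,2) by auto
    have IH: "?r ^ d' * bhattacharyya e k (cyl (?L b))
      \<le> bhattacharyya e k {x \<in> cyl (?L b). run (sub b) x} + bhattacharyya e k {x \<in> cyl (?L b). \<not> run (sub b) x}"
      for b
    proof -
      have "query_count (sub b) x \<le> d'" if "x \<in> bits k \<inter> cyl (?L b)" for x
        using Query.prems(3)[of x] that d' by (auto simp: cyl_insert sub_def split: if_splits)
      then show ?thesis
        using Query.IH(1)[of "?L b" d'] Query.IH(2)[of "?L b" d'] L'[of b] Query.prems(2)
        by (cases b) (auto simp: sub_def)
    qed
    have split: "{x \<in> cyl L. run (Query i t0 t1) x = c}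
      = {x \<in> cyl (?L True). run (sub True) x = c} \<union> {x \<in> cyl (?L False). run (sub False) x = c}" for c
      by (auto simp: cyl_insert sub_def)
    have out: "bhattacharyya e k {x \<in> cyl (?L True). run (sub True) x = c}
        + bhattacharyya e k {x \<in> cyl (?L False). run (sub False) x = c}
      \<le> bhattacharyya e k {x \<in> cyl L. run (Query i t0 t1) x = c}" for c
      unfolding split by (rule bhattacharyya_superadditive[OF e]) (auto simp: cyl_insert)
    have "?r ^ d * bhattacharyya e k (cyl L) = ?r ^ d' * (?r * bhattacharyya e k (cyl L))"
      by (simp add: d')
    also have "\<dots> \<le> ?r ^ d' * (bhattacharyya e k (cyl (?L True)) + bhattacharyya e k (cyl (?L False)))"
      by (intro mult_left_mono r bhattacharyya_query e Query.prems(1) i)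
    finally show ?thesis
      using IH[of True] IH[of False] out[of True] out[of False] by (simp add: distrib_left)
  qed
qed

text \<open>For acceptance probabilities \<open>a\<close> and \<open>b\<close>, the squared
  coefficient of the two outputs is at most \<open>1 - (a - b)^2\<close> and at least
  \<open>(1 - e^2)^q\<close>; Bernoulli's inequality then bounds the advantage.\<close>

lemma tree_advantage:
  assumes e: "\<bar>e\<bar> \<le> 1" and t: "queried_indices t \<subseteq> {..<k}"
    and q: "\<And>x. x \<in> bits k \<Longrightarrow> query_count t x \<le> q"
  shows "(biased_mass e True k {x. run t x} - biased_mass e False k {x. run t x})\<^sup>2 \<le> real q * e\<^sup>2"
proof -
  define a where "a = biased_mass e True k {x. run t x}"
  define b where "b = biased_mass e False k {x. run t x}"
  have compl: "biased_mass e c k {x. \<not> run t x} = 1 - biased_mass e c k {x. run t x}" for c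
  proof -
    have un: "{x. run t x} \<union> {x. \<not> run t x} = UNIV" and disj: "{x. run t x} \<inter> {x. \<not> run t x} = {}"
      by auto
    show ?thesis
      using biased_mass_Un[OF disj, of e c k] biased_mass_UNIV[of e c k] unfolding un by linarith
  qed
  have ab: "0 \<le> a" "0 \<le> b" "0 \<le> 1 - a" "0 \<le> 1 - b"
    unfolding a_def b_def compl[symmetric] by (intro biased_mass_nonneg e)+
  have cyl0: "cyl {} = UNIV" by (simp add: cyl_def)
  have e2: "0 \<le> 1 - e\<^sup>2" using e by (simp add: abs_square_le_1)
  have "sqrt (1 - e\<^sup>2) ^ q \<le> sqrt (a * b) + sqrt ((1 - a) * (1 - b))"
    using bhattacharyya_tree[OF e, of "{}" k t q] t q
    by (simp add: bhattacharyya_def cyl0 biased_mass_UNIV compl a_def b_def)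
  then have "(sqrt (1 - e\<^sup>2) ^ q)\<^sup>2 \<le> (sqrt (a * b) + sqrt ((1 - a) * (1 - b)))\<^sup>2"
    using e2 by (intro power_mono) auto
  moreover have "(sqrt (1 - e\<^sup>2) ^ q)\<^sup>2 = (1 - e\<^sup>2) ^ q"
    using e2 by (simp add: power2_eq_square[of "_ ^ q"] flip: power_mult_distrib)
  moreover have "(sqrt (a * b) + sqrt ((1 - a) * (1 - b)))\<^sup>2 \<le> 1 - (a - b)\<^sup>2"
  proof -
    have "2 * sqrt ((a * (1 - a)) * (b * (1 - b))) \<le> a * (1 - a) + b * (1 - b)"
      using arith_geo_mean_sqrt[of "a * (1 - a)" "b * (1 - b)"] ab by simp
    moreover have "sqrt (a * b) * sqrt ((1 - a) * (1 - b)) = sqrt ((a * (1 - a)) * (b * (1 - b)))"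
      by (simp add: ac_simps flip: real_sqrt_mult)
    ultimately show ?thesis
      using ab by (simp add: power2_sum) (simp add: power2_eq_square algebra_simps)
  qed
  moreover have "1 - real q * e\<^sup>2 \<le> (1 - e\<^sup>2) ^ q"
    using Bernoulli_inequality[of "- e\<^sup>2" q] e2 by simp
  ultimately show ?thesis unfolding a_def[symmetric] b_def[symmetric] by linarith
qed

text \<open>The signed sum has mean \<open>16 * sqrt n\<close>, but below the threshold it is at
  most \<open>6 * sqrt n\<close>. Chebyshev's inequality for a deviation of
  \<open>10 * sqrt n\<close> gives \<open>1/100\<close>, and \<open>256 \<le> n\<close> makes the
  bias at most one.\<close>

lemma biased_mass_below_threshold:
  assumes n: "256 \<le> n"
  defines "e \<equiv> 16 / sqrt (real n)"
  shows "biased_mass e b n {x. count_list x b < majority_threshold n} \<le> 1 / 100"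
proof -
  define r where "r = sqrt (real n)"
  have rr: "r * r = real n" by (simp add: r_def)
  have "sqrt 256 \<le> r" unfolding r_def using n by (intro real_sqrt_le_mono) linarith
  moreover have "sqrt 256 = (16 :: real)" using real_sqrt_abs[of 16] by simp
  ultimately have r: "16 \<le> r" by simp
  have e: "\<bar>e\<bar> \<le> 1" using r by (simp add: e_def r_def[symmetric])
  let ?Cs = "replicate n (UNIV :: bool set)"
  let ?\<sigma> = "\<lambda>(_ :: nat) c. if c = b then 1 else - 1 :: real"
  have "(10 * r)\<^sup>2 * (\<Sum>x | x \<in> listset ?Cs \<and> count_list x b < majority_threshold n. prod_list (map (coin e b) x))
      \<le> real (length ?Cs) * (\<Sum>x\<in>listset ?Cs. prod_list (map (coin e b) x))"
  proof (rule product_Chebyshev[where \<sigma> = ?\<sigma> and \<mu> = "\<lambda>_. e"])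
    fix x assume x: "x \<in> listset ?Cs" "count_list x b < majority_threshold n"
    have len: "length x = n" using x(1) by (simp add: mem_listset_iff)
    have "(\<Sum>i<length ?Cs. ?\<sigma> i (x ! i)) = 2 * real (count_list x b) - real n"
      using signed_sum_count_list[of x b] len by simp
    also have "\<dots> \<le> 6 * r"
      using x(2) majority_threshold_bounds(2)[of n] r by (simp add: r_def[symmetric])
    finally have "(\<Sum>i<length ?Cs. ?\<sigma> i (x ! i)) \<le> 6 * r" .
    moreover have "(\<Sum>i<length ?Cs. e) = 16 * r"
      using r unfolding e_def r_def[symmetric] by (simp add: rr[symmetric])
    ultimately show "10 * r \<le> \<bar>(\<Sum>i<length ?Cs. ?\<sigma> i (x ! i)) - (\<Sum>i<length ?Cs. e)\<bar>" by linarith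
  next
    fix i assume "i < length ?Cs"
    then show "(\<Sum>c\<in>?Cs ! i. coin e b c * ?\<sigma> i c) = e * (\<Sum>c\<in>?Cs ! i. coin e b c)"
      by (cases b) (auto simp: coin_sum, auto simp: coin_def UNIV_bool field_simps)
  qed (use coin_nonneg[OF e] r in \<open>auto simp: coin_sum\<close>)
  moreover have "(\<Sum>x\<in>listset ?Cs. prod_list (map (coin e b) x)) = 1"
    using biased_mass_UNIV[of e b n] by (simp add: biased_mass_def flip: bits_eq_listset)
  moreover have "(\<Sum>x | x \<in> listset ?Cs \<and> count_list x b < majority_threshold n. prod_list (map (coin e b) x))
      = biased_mass e b n {x. count_list x b < majority_threshold n}"
    by (simp add: biased_mass_def Int_def flip: bits_eq_listset)
  ultimately have "real n * (100 * biased_mass e b n {x. count_list x b < majority_threshold n}) \<le> real n * 1"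
    by (simp add: power_mult_distrib power2_eq_square rr)
  then show ?thesis using n by simp
qed

text \<open>Correctness forces average acceptance at least \<open>2/3 - 1/100\<close> under the bias
  towards \<open>True\<close> and at most \<open>1/3 + 1/100\<close> under the other. The gap
  exceeds \<open>1/4\<close>, while \<open>n/4096\<close> queries give advantage at most
  \<open>sqrt (256/4096) = 1/4\<close>.\<close>

lemma gap_majority_lower:
  assumes n: "256 \<le> n" and q: "real q \<le> real n / 4096"
  shows "\<not> has_algorithm (1/3) n (gap_majority n) q"
proof
  assume "has_algorithm (1/3) n (gap_majority n) q"
  then obtain A where A: "query_algorithm n A" "computes_with_error (1/3) n A (gap_majority n)" "max_queries_le n A q"
    unfolding has_algorithm_def by blast
  define e where "e = 16 / sqrt (real n)"
  define k where "k = majority_threshold n"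
  define W where "W = (\<lambda>b x. prod_list (map (coin e b) x))"
  define p where "p = (\<lambda>x. measure_pmf.prob A {t. run t x})"
  have "sqrt 256 \<le> sqrt (real n)" using n by (intro real_sqrt_le_mono) linarith
  moreover have "sqrt 256 = (16 :: real)" using real_sqrt_abs[of 16] by simp
  ultimately have e: "\<bar>e\<bar> \<le> 1" unfolding e_def using n by (simp add: divide_le_eq_1_pos)
  have W: "0 \<le> W b x" for b x unfolding W_def by (rule prod_list_coin_nonneg[OF e])
  have mass: "biased_mass e b n {x. P x} = (\<Sum>x\<in>bits n. W b x * of_bool (P x))" for b P
    using finite_bits[of n] by (auto simp: biased_mass_def W_def Int_def sum.inter_filter intro!: sum.cong)
  have total: "(\<Sum>x\<in>bits n. W b x) = 1" for b
    using mass[of b "\<lambda>_. True"] biased_mass_UNIV[of e b n] by simp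
  have low: "(\<Sum>x\<in>bits n. W b x * of_bool (count_list x b < k)) \<le> 1 / 100" for b
    using biased_mass_below_threshold[OF n, of b] unfolding mass[symmetric] e_def k_def .
  have "(\<Sum>x\<in>bits n. (W True x - W False x) * measure_pmf.prob A {t. run t x}) \<le> 1 / 4"
  proof (rule sum_weighted_prob_le[OF finite_bits])
    fix t assume t: "t \<in> set_pmf A"
    have "(biased_mass e True n {x. run t x} - biased_mass e False n {x. run t x})\<^sup>2 \<le> real q * e\<^sup>2"
      using A t by (intro tree_advantage e) (auto simp: query_algorithm_def max_queries_le_def)
    also have "real q * e\<^sup>2 = 256 * real q / real n" by (simp add: e_def power_divide)
    also have "\<dots> \<le> (1 / 4)\<^sup>2" using q n by (simp add: power2_eq_square field_simps)
    finally have "biased_mass e True n {x. run t x} - biased_mass e False n {x. run t x} \<le> 1 / 4"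
      by (rule power2_le_imp_le) simp
    then show "(\<Sum>x\<in>bits n. (W True x - W False x) * of_bool (run t x)) \<le> 1 / 4"
      unfolding mass by (simp add: left_diff_distrib sum_subtractf)
  qed
  then have up: "(\<Sum>x\<in>bits n. W True x * p x) - (\<Sum>x\<in>bits n. W False x * p x) \<le> 1 / 4"
    by (simp add: left_diff_distrib sum_subtractf p_def)
  have p01: "0 \<le> p x" "p x \<le> 1" for x by (auto simp: p_def)
  have p_True: "2 / 3 \<le> p x" if x: "x \<in> bits n" "k \<le> count_list x True" for x
  proof -
    have "x \<in> preimage (gap_majority n) True" using x by (simp add: preimage_gap_majority k_def)
    then have "(x, c) \<in> gap_majority n \<longleftrightarrow> c" for c by (cases c) (auto simp: preimage_def)
    then have "{t. (x, run t x) \<in> gap_majority n} = {t. run t x}" by simp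
    then show ?thesis using A(2) x(1) by (auto simp: computes_with_error_def p_def)
  qed
  have p_False: "p x \<le> 1 / 3" if x: "x \<in> bits n" "k \<le> count_list x False" for x
  proof -
    have "x \<in> preimage (gap_majority n) False" using x by (simp add: preimage_gap_majority k_def)
    then have "(x, c) \<in> gap_majority n \<longleftrightarrow> \<not> c" for c by (cases c) (auto simp: preimage_def)
    then have "{t. (x, run t x) \<in> gap_majority n} = - {t. run t x}" by auto
    then have "measure_pmf.prob A (- {t. run t x}) \<ge> 2 / 3"
      using A(2) x(1) by (auto simp: computes_with_error_def)
    then show ?thesis
      using measure_pmf.prob_compl[of "{t. run t x}" A] by (simp add: p_def Compl_eq_Diff_UNIV)
  qed
  have "(\<Sum>x\<in>bits n. 2 / 3 * W True x - W True x * of_bool (count_list x True < k)) \<le> (\<Sum>x\<in>bits n. W True x * p x)"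
  proof (rule sum_mono)
    fix x assume x: "x \<in> bits n"
    \<comment> \<open>Below the threshold only \<open>0 \<le> p x\<close> is known; the loss is
      charged to the rare event bounded in \<open>low\<close>.\<close>
    have "2 / 3 - of_bool (count_list x True < k) \<le> p x"
      using p_True[OF x] p01(1)[of x] by (cases "count_list x True < k") auto
    from mult_left_mono[OF this W[of True x]]
    show "2 / 3 * W True x - W True x * of_bool (count_list x True < k) \<le> W True x * p x"
      by (simp add: right_diff_distrib)
  qed
  moreover have "(\<Sum>x\<in>bits n. W False x * p x) \<le> (\<Sum>x\<in>bits n. 1 / 3 * W False x + W False x * of_bool (count_list x False < k))"
  proof (rule sum_mono)
    fix x assume x: "x \<in> bits n"
    have "p x \<le> 1 / 3 + of_bool (count_list x False < k)"
      using p_False[OF x] p01(2)[of x] by (cases "count_list x False < k") auto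
    from mult_left_mono[OF this W[of False x]]
    show "W False x * p x \<le> 1 / 3 * W False x + W False x * of_bool (count_list x False < k)"
      by (simp add: distrib_left)
  qed
  ultimately show False
    using up low[of True] low[of False] total[of True] total[of False]
    by (simp add: sum_subtractf sum.distrib flip: sum_divide_distrib sum_distrib_left)
qed

lemma gap_majority_upper: "has_algorithm (1/3) n (gap_majority n) n"
proof (rule has_algorithm_uniform_seed[where R = "{()}" and js = "\<lambda>_. [0..<n]"
      and F = "\<lambda>_ bs. majority_threshold n \<le> count_list bs True"])
  fix x assume x: "x \<in> bits n"
  then have "map (\<lambda>i. x ! i) [0..<n] = x" using map_nth[of x] by (simp add: bits_def)
  \<comment> \<open>A string below the threshold for \<open>True\<close> is answered
    \<open>False\<close>, which is accepted whether or not the string is valid.\<close>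
  moreover have "(x, majority_threshold n \<le> count_list x True) \<in> gap_majority n"
    using x less_double_majority_threshold[of n] count_list_compl[of x True]
    by (cases "majority_threshold n \<le> count_list x True") (auto simp: gap_majority_def bits_def)
  ultimately show "real (card {r \<in> {()}. (x, majority_threshold n \<le> count_list (map (\<lambda>i. x ! i) [0..<n]) True)
      \<notin> gap_majority n}) \<le> 1 / 3 * real (card {()})" by simp
qed auto

section \<open>Asymptotics of the three query complexities\<close>

lemma bigtheta_real_between:
  fixes c C :: real and h :: "nat \<Rightarrow> real" and R :: "nat \<Rightarrow> nat"
  assumes "0 < c" "\<And>n. 0 \<le> h n"
    and "\<And>n. N \<le> n \<Longrightarrow> c * h n \<le> real (R n)" "\<And>n. N \<le> n \<Longrightarrow> real (R n) \<le> C * h n"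
  shows "(\<lambda>n. real (R n)) \<in> \<Theta>(h)"
proof (rule bigthetaI)
  show "(\<lambda>n. real (R n)) \<in> O(h)"
    using assms(2,4) by (intro bigoI[of _ C] eventually_sequentiallyI[of N]) auto
  show "(\<lambda>n. real (R n)) \<in> \<Omega>(h)"
    using assms by (intro landau_omega.bigI[of c] eventually_sequentiallyI[of N]) auto
qed

text \<open>Some algorithm exists, so the infimum is attained and cannot be one of the refuted
  budgets.\<close>

lemma randomized_query_complexity_gt:
  assumes "has_algorithm \<epsilon> k h q" and "\<And>q. real q \<le> B \<Longrightarrow> \<not> has_algorithm \<epsilon> k h q"
  shows "B < real (randomized_query_complexity \<epsilon> k h)"
  using has_algorithm_randomized_query_complexity[OF assms(1)] assms(2) by (meson not_le)

theorem theorem5: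
  "\<exists>(f :: nat \<Rightarrow> (bool list \<times> bool list) set) (g :: nat \<Rightarrow> (bool list \<times> bool) set).
     (\<forall>n. f n \<subseteq> bits n \<times> bits n \<and> partial_boolean_function n (g n)) \<and>
     (\<lambda>n. real (randomized_query_complexity (4/9) n (f n))) \<in> \<Theta>(\<lambda>n. sqrt (real n)) \<and>
     (\<lambda>n. real (randomized_query_complexity (1/3) n (g n))) \<in> \<Theta>(\<lambda>n. real n) \<and>
     (\<lambda>n. real (randomized_query_complexity (1/3) (n * n) (compose_rel n n (bits n) (f n) (g n))))
        \<in> \<Theta>(\<lambda>n. real n)"
proof (intro exI[of _ close_rel] exI[of _ gap_majority] conjI allI)
  show "close_rel n \<subseteq> bits n \<times> bits n" "partial_boolean_function n (gap_majority n)" for n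
    by (rule close_rel_subset partial_boolean_function_gap_majority)+
  \<comment> \<open>For \<open>25 \<le> n\<close> rounding up costs at most \<open>sqrt n\<close>,
    and \<open>5 * sqrt n \<le> n\<close> keeps the number of queries within the input
    length.\<close>
  have f_alg: "has_algorithm (4/9) n (close_rel n) (nat \<lceil>4 * sqrt (real n)\<rceil>) \<and>
      real (nat \<lceil>4 * sqrt (real n)\<rceil>) \<le> 5 * sqrt (real n)" if n: "25 \<le> n" for n
  proof -
    have "sqrt 25 \<le> sqrt (real n)" using n by (intro real_sqrt_le_mono) linarith
    moreover have "sqrt 25 = (5 :: real)" using real_sqrt_abs[of 5] by simp
    ultimately have r: "5 \<le> sqrt (real n)" by simp
    then have "5 * sqrt (real n) \<le> sqrt (real n) * sqrt (real n)" by (intro mult_right_mono) auto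
    then have rn: "5 * sqrt (real n) \<le> real n" by simp
    have m: "4 * sqrt (real n) \<le> real (nat \<lceil>4 * sqrt (real n)\<rceil>)"
      "real (nat \<lceil>4 * sqrt (real n)\<rceil>) \<le> 4 * sqrt (real n) + 1" using r by linarith+
    have "nat \<lceil>4 * sqrt (real n)\<rceil> \<le> n" using m(2) r rn by linarith
    then have "has_algorithm (4/9) n (close_rel n) (nat \<lceil>4 * sqrt (real n)\<rceil>)"
      using m(1) n by (intro close_rel_upper) auto
    moreover have "real (nat \<lceil>4 * sqrt (real n)\<rceil>) \<le> 5 * sqrt (real n)" using m(2) r by linarith
    ultimately show ?thesis by blast
  qed
  show "(\<lambda>n. real (randomized_query_complexity (4/9) n (close_rel n))) \<in> \<Theta>(\<lambda>n. sqrt (real n))"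
  proof (rule bigtheta_real_between[where c = "1/2" and C = 5 and N = 25])
    fix n :: nat assume n: "25 \<le> n"
    have "sqrt (real n) / 2 < real (randomized_query_complexity (4/9) n (close_rel n))"
      using f_alg[OF n] close_rel_lower[of n] n by (intro randomized_query_complexity_gt) auto
    then show "1/2 * sqrt (real n) \<le> real (randomized_query_complexity (4/9) n (close_rel n))" by simp
    show "real (randomized_query_complexity (4/9) n (close_rel n)) \<le> 5 * sqrt (real n)"
      using f_alg[OF n] randomized_query_complexity_le[OF conjunct1[OF f_alg[OF n]]] by linarith
  qed auto
  show "(\<lambda>n. real (randomized_query_complexity (1/3) n (gap_majority n))) \<in> \<Theta>(\<lambda>n. real n)"
  proof (rule bigtheta_real_between[where c = "1/4096" and C = 1 and N = 256])
    fix n :: nat assume n: "256 \<le> n"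
    have "real n / 4096 < real (randomized_query_complexity (1/3) n (gap_majority n))"
      using gap_majority_upper gap_majority_lower[OF n] by (rule randomized_query_complexity_gt)
    then show "1/4096 * real n \<le> real (randomized_query_complexity (1/3) n (gap_majority n))" by simp
    show "real (randomized_query_complexity (1/3) n (gap_majority n)) \<le> 1 * real n"
      using randomized_query_complexity_le[OF gap_majority_upper] by simp
  qed auto
  show "(\<lambda>n. real (randomized_query_complexity (1/3) (n * n)
      (compose_rel n n (bits n) (close_rel n) (gap_majority n)))) \<in> \<Theta>(\<lambda>n. real n)"
  proof (rule bigtheta_real_between[where c = "1/48" and C = 1 and N = 576])
    fix n :: nat assume n: "576 \<le> n"
    let ?h = "compose_rel n n (bits n) (close_rel n) (gap_majority n)"
    have up: "has_algorithm (1/3) (n * n) ?h n" using n by (intro compose_upper) simp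
    have "real n / 48 < real (randomized_query_complexity (1/3) (n * n) ?h)"
      using up compose_lower[OF n] by (rule randomized_query_complexity_gt)
    then show "1/48 * real n \<le> real (randomized_query_complexity (1/3) (n * n) ?h)" by simp
    show "real (randomized_query_complexity (1/3) (n * n) ?h) \<le> 1 * real n"
      using randomized_query_complexity_le[OF up] by simp
  qed auto
qed

end
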